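(* Assume $\nu(X)<+\infty$. If $[X,d,m,\nu]$ satisfies a $2$-Poincaré inequality then, for any $u_0\in L^2(X,\nu)$, $$\|e^{t\Delta_1^m}u_0-\nu(u_0)\|_{L^2(X,\nu)}\le\left(\|u_0-\nu(u_0)\|_{L^2(X,\nu)}-\lambda^2_{[X,d,m,\nu]}\,t\right)^+\qquad\text{for all } t\ge0.$$ Consequently, $$e^{t\Delta_1^m}u_0=\nu(u_0)\qquad\text{for all } t\ge\hat t:=\frac{\|u_0-\nu(u_0)\|_{L^2(X,\nu)}}{\lambda^2_{[X,d,m,\nu]}}.$$
   Context: Metric random walk space: $(X,d)$ is a Polish metric space with its Borel $\sigma$-algebra and $m=(m_x)_{x\in X}$ is a family of Borel probability measures on $X$ such that $x\mapsto m_x(A)$ is Borel for every Borel set $A$, and each $m_x$ has finite first moment ($\int_X d(z,y)\,dm_x(y)<\infty$ for some, hence every, $z\in X$). $\nu$ is a $\sigma$-finite Radon measure on $X$ that is invariant, $\nu(A)=\int_X m_x(A)\,d\nu(x)$, and reversible for $m$: for every Borel $C\subset X\times X$, $\int_X\int_X\chi_C(x,y)\,dm_x(y)d\nu(x)=\int_X\int_X\chi_C(x,y)\,dm_y(x)d\nu(y)$. Put $L_m(A,B)=\int_A\int_B dm_x(y)d\nu(x)$; the space is assumed $m$-connected: $L_m(A,B)>0$ for any $\nu$-measurable sets $A,B$ of positive $\nu$-measure with $A\cup B=X$. For $\nu$-measurable $u:X\to\mathbb R$, $TV_m(u)=\frac12\int_X\int_X|u(y)-u(x)|\,dm_x(y)d\nu(x)\in[0,\infty]$.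 Define $\mathcal F_m:L^2(X,\nu)\to[0,+\infty]$ by $\mathcal F_m(u)=TV_m(u)$. $w\in\partial\mathcal F_m(u)$ iff $\mathcal F_m(u)<\infty$ and $\mathcal F_m(z)\ge\mathcal F_m(u)+\int_X w(z-u)\,d\nu$ for all $z\in L^2(X,\nu)$. The multivalued operator $\Delta_1^m$ in $L^2(X,\nu)$: $v\in\Delta_1^m u$ iff $-v\in\partial\mathcal F_m(u)$. For $u_0\in L^2(X,\nu)$, $t\mapsto e^{t\Delta_1^m}u_0$ denotes the unique solution $u$ of $u_t\in\Delta_1^m u$, $u(0)=u_0$, in the sense that for every $T>0$: $u\in W^{1,1}(0,T;L^2(X,\nu))$, $u(0)=u_0$, and $u_t(t)\in\Delta_1^m u(t)$ for almost all $t\in(0,T)$. $\nu(u):=\frac1{\nu(X)}\int_X u\,d\nu$ and $r^+=\max\{r,0\}$. For $p\ge1$, $[X,d,m,\nu]$ satisfies a $p$-Poincaré inequality if there is $c>0$ such that $\|u\|_{L^p(X,\nu)}\le c\left(\int_X\int_X|u(y)-u(x)|\,dm_x(y)d\nu(x)+\left|\int_X u\,d\nu\right|\right)$ for all $u\in L^1(X,\nu)$. In that case $$\lambda^p_{[X,d,m,\nu]}:=\inf\left\{\frac{TV_m(u)}{\|u\|_{L^p(X,\nu)}}: u\in L^1(X,\nu),\ \|u\|_{L^p(X,\nu)}\ne0,\ \int_X u\,d\nu=0\right\}.$$ *)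

theory Defs
  imports "HOL-Probability.Probability"
begin

locale metric_random_walk_space =
  fixes m :: "'a::polish_space \<Rightarrow> 'a measure"
  assumes prob_m: "prob_space (m x)"
    and sets_m: "sets (m x) = sets borel"
    and measurable_m: "A \<in> sets borel \<Longrightarrow> (\<lambda>x. emeasure (m x) A) \<in> borel_measurable borel"
    and first_moment: "\<exists>z. (\<integral>\<^sup>+y. ennreal (dist z y) \<partial>m x) < \<infinity>"

definition radon_measure :: "'a::topological_space measure \<Rightarrow> bool" where
  "radon_measure \<nu> \<longleftrightarrow>
     sets \<nu> = sets borel \<and>
     (\<forall>x. \<exists>U. open U \<and> x \<in> U \<and> emeasure \<nu> U < \<infinity>) \<and>
     (\<forall>A\<in>sets borel. emeasure \<nu> A = (SUP K\<in>{K. compact K \<and> K \<subseteq> A}. emeasure \<nu> K))"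

locale reversible_metric_random_walk_space = metric_random_walk_space m
  for m :: "'a::polish_space \<Rightarrow> 'a measure" +
  fixes \<nu> :: "'a measure"
  assumes radon: "radon_measure \<nu>"
    and sigma_finite: "sigma_finite_measure \<nu>"
    and invariant: "A \<in> sets borel \<Longrightarrow> emeasure \<nu> A = (\<integral>\<^sup>+x. emeasure (m x) A \<partial>\<nu>)"
    and reversible: "C \<in> sets (borel :: ('a \<times> 'a) measure) \<Longrightarrow>
      (\<integral>\<^sup>+x. (\<integral>\<^sup>+y. indicator C (x, y) \<partial>m x) \<partial>\<nu>) =
      (\<integral>\<^sup>+y. (\<integral>\<^sup>+x. indicator C (x, y) \<partial>m y) \<partial>\<nu>)"

definition interaction :: "('a \<Rightarrow> 'a measure) \<Rightarrow> 'a measure \<Rightarrow> 'a set \<Rightarrow> 'a set \<Rightarrow> ennreal" where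
  "interaction m \<nu> A B = (\<integral>\<^sup>+x\<in>A. (\<integral>\<^sup>+y\<in>B. 1 \<partial>m x) \<partial>\<nu>)"

definition m_connected :: "('a \<Rightarrow> 'a measure) \<Rightarrow> 'a measure \<Rightarrow> bool" where
  "m_connected m \<nu> \<longleftrightarrow>
     (\<forall>A\<in>sets \<nu>. \<forall>B\<in>sets \<nu>. emeasure \<nu> A > 0 \<longrightarrow> emeasure \<nu> B > 0 \<longrightarrow> A \<union> B = space \<nu> \<longrightarrow>
        interaction m \<nu> A B > 0)"

text \<open>Norms take values in \<open>[0,\<infinity>]\<close>, so that nothing is hidden by the convention that
  the Bochner integral of a non-integrable function is 0. Elements of \<open>L\<^sup>p\<close> are represented by
  measurable functions; equality in \<open>L\<^sup>p\<close> is equality almost everywhere.\<close>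

definition Lp_norm :: "real \<Rightarrow> 'a measure \<Rightarrow> ('a \<Rightarrow> real) \<Rightarrow> ennreal" where
  "Lp_norm p \<nu> u =
     (let I = (\<integral>\<^sup>+x. ennreal (\<bar>u x\<bar> powr p) \<partial>\<nu>)
      in if I = \<infinity> then \<infinity> else ennreal (enn2real I powr (1 / p)))"

definition Lp_space :: "real \<Rightarrow> 'a measure \<Rightarrow> ('a \<Rightarrow> real) set" where
  "Lp_space p \<nu> = {u \<in> borel_measurable \<nu>. Lp_norm p \<nu> u < \<infinity>}"

definition mean :: "'a measure \<Rightarrow> ('a \<Rightarrow> real) \<Rightarrow> real" where
  "mean \<nu> u = 1 / measure \<nu> (space \<nu>) * (\<integral>x. u x \<partial>\<nu>)"

definition TV :: "('a \<Rightarrow> 'a measure) \<Rightarrow> 'a measure \<Rightarrow> ('a \<Rightarrow> real) \<Rightarrow> ennreal" where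
  "TV m \<nu> u = ennreal (1 / 2) * (\<integral>\<^sup>+x. (\<integral>\<^sup>+y. ennreal \<bar>u y - u x\<bar> \<partial>m x) \<partial>\<nu>)"

definition TV_subdifferential ::
    "('a \<Rightarrow> 'a measure) \<Rightarrow> 'a measure \<Rightarrow> ('a \<Rightarrow> real) \<Rightarrow> ('a \<Rightarrow> real) set" where
  "TV_subdifferential m \<nu> u =
     {w \<in> Lp_space 2 \<nu>. u \<in> Lp_space 2 \<nu> \<and> TV m \<nu> u < \<infinity> \<and>
        (\<forall>z\<in>Lp_space 2 \<nu>.
           enn2ereal (TV m \<nu> z) \<ge> enn2ereal (TV m \<nu> u) + ereal (\<integral>x. w x * (z x - u x) \<partial>\<nu>))}"

definition one_laplacian ::
    "('a \<Rightarrow> 'a measure) \<Rightarrow> 'a measure \<Rightarrow> ('a \<Rightarrow> real) \<Rightarrow> ('a \<Rightarrow> real) set" where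
  "one_laplacian m \<nu> u = {v. (\<lambda>x. - v x) \<in> TV_subdifferential m \<nu> u}"

definition poincare_inequality :: "real \<Rightarrow> ('a \<Rightarrow> 'a measure) \<Rightarrow> 'a measure \<Rightarrow> bool" where
  "poincare_inequality p m \<nu> \<longleftrightarrow>
     (\<exists>c>0. \<forall>u\<in>Lp_space 1 \<nu>.
        Lp_norm p \<nu> u \<le> ennreal c *
          ((\<integral>\<^sup>+x. (\<integral>\<^sup>+y. ennreal \<bar>u y - u x\<bar> \<partial>m x) \<partial>\<nu>) + ennreal \<bar>\<integral>x. u x \<partial>\<nu>\<bar>))"

text \<open>The infimum is taken in \<open>[0,\<infinity>]\<close>, so it is \<open>\<infinity>\<close> if there is no admissible \<open>u\<close>
  (for instance if \<open>\<nu>\<close> is a point mass).\<close>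

definition poincare_constant :: "real \<Rightarrow> ('a \<Rightarrow> 'a measure) \<Rightarrow> 'a measure \<Rightarrow> ennreal" where
  "poincare_constant p m \<nu> =
     (INF u\<in>{u \<in> Lp_space 1 \<nu>. Lp_norm p \<nu> u \<noteq> 0 \<and> (\<integral>x. u x \<partial>\<nu>) = 0}.
        TV m \<nu> u / Lp_norm p \<nu> u)"

text \<open>The library's Bochner integral needs a Banach space type, and \<open>L\<^sup>2(\<nu>)\<close> is not one because
  it depends on \<open>\<nu>\<close>. The following definitions repeat the library's construction (see
  \<open>has_bochner_integral\<close>) for functions with values in \<open>L\<^sup>2(\<nu>)\<close>. Strong measurability
  is part of the definition; it makes \<open>t \<mapsto> \<parallel>f t\<parallel>\<close> measurable up to a null set.\<close>

definition L2_simple :: "'t measure \<Rightarrow> 'a measure \<Rightarrow> ('t \<Rightarrow> 'a \<Rightarrow> real) \<Rightarrow> bool" where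
  "L2_simple M \<nu> s \<longleftrightarrow>
     simple_function M s \<and> (\<forall>t\<in>space M. s t \<in> Lp_space 2 \<nu>) \<and>
     emeasure M {t \<in> space M. s t \<noteq> (\<lambda>x. 0)} < \<infinity>"

definition L2_simple_integral :: "'t measure \<Rightarrow> ('t \<Rightarrow> 'a \<Rightarrow> real) \<Rightarrow> 'a \<Rightarrow> real" where
  "L2_simple_integral M s x = (\<Sum>g\<in>s ` space M. measure M {t \<in> space M. s t = g} * g x)"

definition L2_strongly_measurable :: "'t measure \<Rightarrow> 'a measure \<Rightarrow> ('t \<Rightarrow> 'a \<Rightarrow> real) \<Rightarrow> bool" where
  "L2_strongly_measurable M \<nu> f \<longleftrightarrow>
     (\<forall>t\<in>space M. f t \<in> Lp_space 2 \<nu>) \<and>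
     (\<exists>s. (\<forall>i. L2_simple M \<nu> (s i)) \<and>
        (AE t in M. (\<lambda>i. Lp_norm 2 \<nu> (\<lambda>x. f t x - s i t x)) \<longlonglongrightarrow> 0))"

definition L2_integrable :: "'t measure \<Rightarrow> 'a measure \<Rightarrow> ('t \<Rightarrow> 'a \<Rightarrow> real) \<Rightarrow> bool" where
  "L2_integrable M \<nu> f \<longleftrightarrow>
     L2_strongly_measurable M \<nu> f \<and> (\<integral>\<^sup>+t. Lp_norm 2 \<nu> (f t) \<partial>M) < \<infinity>"

definition has_L2_integral ::
    "'t measure \<Rightarrow> 'a measure \<Rightarrow> ('t \<Rightarrow> 'a \<Rightarrow> real) \<Rightarrow> ('a \<Rightarrow> real) \<Rightarrow> bool" where
  "has_L2_integral M \<nu> f g \<longleftrightarrow>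
     L2_strongly_measurable M \<nu> f \<and> g \<in> Lp_space 2 \<nu> \<and>
     (\<exists>s. (\<forall>i. L2_simple M \<nu> (s i)) \<and>
        (\<lambda>i. \<integral>\<^sup>+t. Lp_norm 2 \<nu> (\<lambda>x. f t x - s i t x) \<partial>M) \<longlonglongrightarrow> 0 \<and>
        (\<lambda>i. Lp_norm 2 \<nu> (\<lambda>x. L2_simple_integral M (s i) x - g x)) \<longlonglongrightarrow> 0)"

text \<open>\<open>C\<^sub>c\<^sup>\<infinity>(0,T)\<close>; \<open>D k\<close> is the \<open>k\<close>-th derivative of \<open>\<phi>\<close>.\<close>

definition test_function :: "real \<Rightarrow> (real \<Rightarrow> real) \<Rightarrow> bool" where
  "test_function T \<phi> \<longleftrightarrow>
     (\<exists>D. D 0 = \<phi> \<and> (\<forall>k t. (D k has_real_derivative D (Suc k) t) (at t))) \<and>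
     (\<exists>K. compact K \<and> K \<subseteq> {0<..<T} \<and> (\<forall>t. t \<notin> K \<longrightarrow> \<phi> t = 0))"

text \<open>\<open>u \<in> W\<^sup>1\<^sup>,\<^sup>1(0,T;L\<^sup>2(\<nu>))\<close> with distributional derivative \<open>v\<close>.\<close>

definition W11_derivative ::
    "real \<Rightarrow> 'a measure \<Rightarrow> (real \<Rightarrow> 'a \<Rightarrow> real) \<Rightarrow> (real \<Rightarrow> 'a \<Rightarrow> real) \<Rightarrow> bool" where
  "W11_derivative T \<nu> u v \<longleftrightarrow>
     (let M = restrict_space lborel {0<..<T} in
        L2_integrable M \<nu> u \<and> L2_integrable M \<nu> v \<and>
        (\<forall>\<phi>. test_function T \<phi> \<longrightarrow>
           (\<exists>g. has_L2_integral M \<nu> (\<lambda>t x. deriv \<phi> t * u t x) g \<and>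
                has_L2_integral M \<nu> (\<lambda>t x. \<phi> t * v t x) (\<lambda>x. - g x))))"

text \<open>\<open>u t\<close> is the value at time \<open>t\<close> of the flow from \<open>u0\<close>. Point values in \<open>t\<close> of an element of
  \<open>W\<^sup>1\<^sup>,\<^sup>1(0,T;L\<^sup>2(\<nu>))\<close> are those of its continuous representative, hence the continuity clause.
  Such \<open>u\<close> is unique up to \<open>\<nu>\<close>-null sets at each \<open>t \<ge> 0\<close>.\<close>

definition total_variation_flow ::
    "('a \<Rightarrow> 'a measure) \<Rightarrow> 'a measure \<Rightarrow> ('a \<Rightarrow> real) \<Rightarrow> (real \<Rightarrow> 'a \<Rightarrow> real) \<Rightarrow> bool" where
  "total_variation_flow m \<nu> u0 u \<longleftrightarrow>
     (\<forall>t\<ge>0. u t \<in> Lp_space 2 \<nu>) \<and>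
     (\<forall>t\<ge>0. ((\<lambda>s. Lp_norm 2 \<nu> (\<lambda>x. u s x - u t x)) \<longlongrightarrow> 0) (at t within {0..})) \<and>
     (AE x in \<nu>. u 0 x = u0 x) \<and>
     (\<forall>T>0. \<exists>v. W11_derivative T \<nu> u v \<and>
        (AE t in lborel. t \<in> {0<..<T} \<longrightarrow> v t \<in> one_laplacian m \<nu> (u t)))"

end

theory Submission
  imports Defs
begin

text \<open>Write \<open>c\<close> for the mean of \<open>u0\<close>, \<open>U t = u t - c\<close> and \<open>N t = \<parallel>U t\<parallel>\<close> for the \<open>L\<^sup>2\<close> norm, and let
  \<open>v\<close> be the velocity of the flow, so that \<open>- v\<close> is a subgradient of the total variation at \<open>u\<close>.

  The total variation does not see constants. Hence \<open>v\<close> is orthogonal to constants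
  (\<open>one_laplacian_integral_0\<close>), the mean of \<open>u t\<close> is conserved (\<open>flow_mass_conservation\<close>), and \<open>U t\<close>
  is a competitor in the definition of the Poincare constant. Comparing \<open>u\<close> with the constant \<open>c\<close>
  in the subgradient inequality gives \<open>\<langle>v, U\<rangle> \<le> - TV u \<le> - lam N\<close> for every real \<open>lam \<ge> 0\<close> below the
  Poincare constant (\<open>one_laplacian_dissipation\<close>). Formally the left side is the derivative of
  \<open>N\<^sup>2 / 2\<close>, so \<open>N\<close> decreases with slope at least \<open>lam\<close> while it is positive, and once it is zero it
  stays zero (\<open>flow_norm_decay\<close>). Extinction at time \<open>\<parallel>u0 - c\<parallel> / lam\<close> is the zero of this bound.

  The equation holds only in the sense of distributions with values in \<open>L\<^sup>2\<close>. Instead of a chain rule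
  for \<open>N\<^sup>2\<close>, the proof pairs the equation with fixed elements \<open>h\<close>: this turns it into a scalar
  distributional equation, and testing with smoothed indicator functions yields the increments of
  \<open>\<langle>u t, h\<rangle>\<close> as integrals of \<open>\<langle>v, h\<rangle>\<close> (\<open>weak_derivative_FTC\<close>, \<open>W11_pairing_FTC\<close>). Choosing
  \<open>h = U t\<close> on short intervals ending at \<open>t\<close>, where \<open>u\<close> hardly moves, recovers the differential
  inequality up to a relative error that vanishes with the length of the intervals
  (\<open>flow_norm_decrease_positive\<close>).\<close>

section \<open>Smooth step functions\<close>

text \<open>The functions \<open>p (1 / x) * exp (- 1 / x)\<close>, extended by 0 to the left half-line. Allowing an
  arbitrary polynomial \<open>p\<close> makes the family closed under differentiation, which gives smoothness
  without a formula for the higher derivatives.\<close>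

definition flat :: "real poly \<Rightarrow> real \<Rightarrow> real" where
  "flat p x = (if x > 0 then poly p (1 / x) * exp (- (1 / x)) else 0)"

lemma poly_times_exp_tendsto_0: "((\<lambda>y::real. poly p y * exp (- y)) \<longlongrightarrow> 0) at_top"
proof -
  have "((\<lambda>y. \<Sum>i\<le>degree p. coeff p i * (y ^ i / exp y)) \<longlongrightarrow> (\<Sum>i\<le>degree p. coeff p i * 0)) at_top"
    by (intro tendsto_intros tendsto_power_div_exp_0)
  moreover have "(\<Sum>i\<le>degree p. coeff p i * (y ^ i / exp y)) = poly p y * exp (- y)" for y :: real
    by (simp add: poly_altdef sum_distrib_right exp_minus divide_inverse mult.assoc)
  ultimately show ?thesis by simp
qed

text \<open>The interesting point is \<open>x = 0\<close>: with \<open>y = 1 / h\<close> the difference quotient from the right is a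
  polynomial in \<open>y\<close> times \<open>exp (- y)\<close>, and it tends to 0 as \<open>y\<close> grows.\<close>

lemma flat_has_derivative:
  "(flat p has_real_derivative flat ([:0, 0, 1:] * (p - pderiv p)) x) (at x)"
proof -
  consider "x > 0" | "x < 0" | "x = 0" by linarith
  then show ?thesis
  proof cases
    case 1
    have "((\<lambda>x. poly p (1 / x) * exp (- (1 / x))) has_real_derivative
        flat ([:0, 0, 1:] * (p - pderiv p)) x) (at x)"
      using 1
      by (auto intro!: derivative_eq_intros DERIV_chain'[OF _ poly_DERIV]
          simp: flat_def field_simps power2_eq_square)
    moreover have "\<forall>\<^sub>F y in nhds x. poly p (1 / y) * exp (- (1 / y)) = flat p y"
      using eventually_nhds_in_open[of "{0<..}" x] 1
      by (auto elim!: eventually_mono simp: flat_def)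
    ultimately show ?thesis
      by (subst (asm) DERIV_cong_ev) auto
  next
    case 2
    have "\<forall>\<^sub>F y in nhds x. 0 = flat p y"
      using eventually_nhds_in_open[of "{..<0}" x] 2
      by (auto elim!: eventually_mono simp: flat_def)
    then have "(flat p has_real_derivative 0) (at x)"
      using DERIV_cong_ev[of x x "\<lambda>_. 0" "flat p" 0 0] by auto
    then show ?thesis using 2 by (simp add: flat_def)
  next
    case 3
    have "((\<lambda>h. poly (pCons 0 p) (inverse h) * exp (- inverse h)) \<longlongrightarrow> 0) (at_right (0::real))"
      by (rule filterlim_compose[OF poly_times_exp_tendsto_0 filterlim_inverse_at_top_right])
    then have r: "((\<lambda>h. flat p h / h) \<longlongrightarrow> 0) (at_right 0)"
      by (rule Lim_transform_eventually)
        (auto simp: eventually_at_filter flat_def field_simps)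
    have l: "((\<lambda>h. flat p h / h) \<longlongrightarrow> 0) (at_left 0)"
      by (rule Lim_transform_eventually[OF tendsto_const])
        (auto simp: eventually_at_filter flat_def)
    have "((\<lambda>h. flat p h / h) \<longlongrightarrow> 0) (at 0)"
      using l r by (simp add: filterlim_at_split)
    then show ?thesis
      unfolding 3 DERIV_def by (simp add: flat_def)
  qed
qed

text \<open>Compactly supported combinations of flat functions. By the product rule the derivative of a
  generator is a difference of two generators, so this class is closed under differentiation and all
  its members are smooth.\<close>

inductive bump_alg :: "(real \<Rightarrow> real) \<Rightarrow> bool" where
  gen: "bump_alg (\<lambda>x. flat p (1 + x) * flat q (1 - x))"
| diff: "bump_alg f \<Longrightarrow> bump_alg g \<Longrightarrow> bump_alg (\<lambda>x. f x - g x)"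

lemma bump_alg_derivative:
  "bump_alg f \<Longrightarrow> \<exists>f'. bump_alg f' \<and> (\<forall>x. (f has_real_derivative f' x) (at x))"
proof (induction rule: bump_alg.induct)
  case (gen p q)
  let ?d = "\<lambda>p. [:0, 0, 1:] * (p - pderiv p) :: real poly"
  have l: "((\<lambda>x. flat p (1 + x)) has_real_derivative flat (?d p) (1 + x)) (at x)" for x
    by (rule DERIV_chain'[OF _ flat_has_derivative, THEN DERIV_cong])
      (auto intro!: derivative_eq_intros)
  have r: "((\<lambda>x. flat q (1 - x)) has_real_derivative - flat (?d q) (1 - x)) (at x)" for x
    by (rule DERIV_chain'[OF _ flat_has_derivative, THEN DERIV_cong])
      (auto intro!: derivative_eq_intros)
  let ?f' = "\<lambda>x. flat (?d p) (1 + x) * flat q (1 - x) - flat p (1 + x) * flat (?d q) (1 - x)"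
  have "((\<lambda>x. flat p (1 + x) * flat q (1 - x)) has_real_derivative ?f' x) (at x)" for x
    by (rule DERIV_mult[OF l r, THEN DERIV_cong]) (simp add: algebra_simps)
  moreover have "bump_alg ?f'"
    by (intro bump_alg.intros)
  ultimately show ?case by blast
next
  case (diff f g)
  then obtain f' g' where "bump_alg f'" "bump_alg g'"
    "\<And>x. (f has_real_derivative f' x) (at x)" "\<And>x. (g has_real_derivative g' x) (at x)"
    by blast
  then show ?case
    by (intro exI[of _ "\<lambda>x. f' x - g' x"]) (auto intro!: bump_alg.diff DERIV_diff)
qed

text \<open>A smooth monotone transition from 0 to 1. It is the normalised primitive of a bump
  function. The sequence \<open>D\<close> lists the function and all its derivatives, which is the form in which
  smoothness of test functions is expressed.\<close>

lemma smooth_step_exists: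
  obtains D :: "nat \<Rightarrow> real \<Rightarrow> real"
  where "\<And>k x. (D k has_real_derivative D (Suc k) x) (at x)"
    and "\<And>x. D 1 x \<ge> 0" and "\<And>x. \<bar>x\<bar> \<ge> 1 \<Longrightarrow> D 1 x = 0"
    and "\<And>x. x \<le> -1 \<Longrightarrow> D 0 x = 0" and "\<And>x. x \<ge> 1 \<Longrightarrow> D 0 x = 1"
proof -
  obtain d where d: "\<And>f. bump_alg f \<Longrightarrow> bump_alg (d f)"
    "\<And>f x. bump_alg f \<Longrightarrow> (f has_real_derivative d f x) (at x)"
    using bump_alg_derivative by metis
  define b where "b = (\<lambda>x. flat 1 (1 + x) * flat 1 (1 - x))"
  have b: "bump_alg b" unfolding b_def by (rule gen)
  have iter: "bump_alg ((d ^^ k) b)" for k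
    by (induction k) (auto intro: b d)
  have b_nonneg: "b x \<ge> 0" for x by (simp add: b_def flat_def)
  have b_outside: "b x = 0" if "\<bar>x\<bar> \<ge> 1" for x
    using that by (auto simp: b_def flat_def)
  have "\<exists>F. \<forall>x. -\<infinity> < ereal x \<longrightarrow> ereal x < \<infinity> \<longrightarrow> (F has_vector_derivative b x) (at x)"
    by (intro einterval_antiderivative) (auto intro: DERIV_isCont d(2)[OF b])
  then obtain F where F: "\<And>x. (F has_real_derivative b x) (at x)"
    by (auto simp: has_real_derivative_iff_has_vector_derivative)
  have const: "F x = F y" if "x < y" "\<And>z. x < z \<Longrightarrow> z < y \<Longrightarrow> b z = 0" for x y
  proof -
    obtain z where "z > x" "z < y" "F y - F x = (y - x) * b z"
      using MVT2[OF \<open>x < y\<close>, of F b] F by blast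
    then show ?thesis using that by simp
  qed
  obtain z where z: "z > -1" "z < 1" "F 1 - F (-1) = 2 * b z"
    using MVT2[of "-1" 1 F b] F by auto
  then have "b z > 0" by (simp add: b_def flat_def)
  then have pos: "F 1 - F (-1) > 0" using z by simp
  define c where "c = F 1 - F (-1)"
  define D where "D k x = (case k of 0 \<Rightarrow> (F x - F (-1)) / c | Suc j \<Rightarrow> (d ^^ j) b x / c)" for k x
  show thesis
  proof
    fix k x
    show "(D k has_real_derivative D (Suc k) x) (at x)"
    proof (cases k)
      case 0
      have "((\<lambda>x. (F x - F (-1)) / c) has_real_derivative (b x - 0) / c) (at x)"
        by (intro DERIV_cdivide DERIV_diff F DERIV_const)
      then show ?thesis by (simp add: 0 D_def[abs_def])
    next
      case (Suc j)
      have "((\<lambda>x. (d ^^ j) b x / c) has_real_derivative (d ^^ Suc j) b x / c) (at x)"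
        using d(2)[OF iter[of j]] by (auto intro!: DERIV_cdivide)
      then show ?thesis by (simp add: Suc D_def[abs_def])
    qed
  next
    fix x show "D 1 x \<ge> 0" using b_nonneg pos by (simp add: D_def c_def)
  next
    fix x :: real assume "\<bar>x\<bar> \<ge> 1" then show "D 1 x = 0" by (simp add: D_def b_outside)
  next
    fix x :: real assume "x \<le> -1"
    then show "D 0 x = 0"
      using const[of x "-1"] b_outside by (cases "x = -1") (auto simp: D_def)
  next
    fix x :: real assume "x \<ge> 1"
    then show "D 0 x = 1"
      using const[of 1 x] b_outside pos by (cases "x = 1") (auto simp: D_def c_def)
  qed
qed

section \<open>From distributional derivatives to increments\<close>

text \<open>Testing with smooth functions \<open>\<phi>\<^sub>n\<close> that converge to the indicator of \<open>[s, t]\<close> turns the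
  distributional identity into the fundamental theorem of calculus. Here \<open>\<phi>\<^sub>n\<close> is the
  difference of two steepened smooth steps at \<open>s\<close> and \<open>t\<close>; its derivative is an
  approximate unit mass at \<open>s\<close> minus one at \<open>t\<close>, so the left side tends to
  \<open>q s - q t\<close> by continuity, and the right side converges by dominated convergence.\<close>

lemma weak_derivative_FTC:
  fixes p q :: "real \<Rightarrow> real"
  assumes st: "0 < s" "s < t" "t < T"
    and q: "continuous_on {0..T} q"
    and p: "set_integrable lborel {0<..<T} p"
    and weak: "\<And>\<phi>. test_function T \<phi> \<Longrightarrow>
      (LINT r:{0<..<T}|lborel. deriv \<phi> r * q r) = - (LINT r:{0<..<T}|lborel. \<phi> r * p r)"
  shows "q t - q s = (LINT r:{s..t}|lborel. p r)"
proof -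
  obtain D :: "nat \<Rightarrow> real \<Rightarrow> real"
    where D: "\<And>k x. (D k has_real_derivative D (Suc k) x) (at x)"
      and nonneg: "\<And>x. D 1 x \<ge> 0" and outside: "\<And>x. \<bar>x\<bar> \<ge> 1 \<Longrightarrow> D 1 x = 0"
      and left: "\<And>x. x \<le> -1 \<Longrightarrow> D 0 x = 0" and right: "\<And>x. x \<ge> 1 \<Longrightarrow> D 0 x = 1"
    using smooth_step_exists by metis
  have D_cont: "continuous_on UNIV (D k)" for k
    by (auto intro!: continuous_at_imp_continuous_on DERIV_isCont D)
  have [measurable]: "D k \<in> borel_measurable borel" for k
    by (rule borel_measurable_continuous_onI[OF D_cont])
  have mono: "D 0 x \<le> D 0 y" if "x \<le> y" for x y
    by (rule DERIV_nonneg_imp_nondecreasing[OF that]) (use D nonneg in fastforce)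
  have D0: "0 \<le> D 0 x" "D 0 x \<le> 1" for x
    using mono[of "min x (-1)" x] left[of "min x (-1)"] mono[of x "max x 1"] right[of "max x 1"]
    by auto
  have "has_bochner_integral lborel (\<lambda>x. D 1 x * indicator {-1..1} x) (D 0 1 - D 0 (-1))"
    by (rule has_bochner_integral_FTC_Icc_nonneg) (use D nonneg in \<open>auto simp: D_cont\<close>)
  moreover have "(\<lambda>x. D 1 x * indicator {-1..1} x) = D 1"
  proof
    fix x show "D 1 x * indicator {-1..1} x = D 1 x"
      using outside[of x] by (cases "\<bar>x\<bar> \<ge> 1") (auto simp: indicator_def)
  qed
  ultimately have D1: "integrable lborel (D 1)" "(\<integral>x. D 1 x \<partial>lborel) = 1"
    using left[of "-1"] right[of 1] by (auto simp: has_bochner_integral_iff)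
  define A where "A = {0<..<T}"
  define Q where "Q r = indicator A r * q r" for r
  define P where "P r = indicator A r * p r" for r
  have "A \<subseteq> {0..T}" by (auto simp: A_def)
  then have q_A: "continuous_on A q" by (rule continuous_on_subset[OF q])
  have [measurable]: "Q \<in> borel_measurable borel"
    using borel_measurable_continuous_on_indicator[of A q] q_A
    by (auto simp: A_def Q_def[abs_def])
  have P: "integrable lborel P"
    using p by (simp add: set_integrable_def A_def P_def[abs_def])
  note [measurable] = borel_measurable_integrable[OF P]
  obtain B where B: "\<And>r. r \<in> {0..T} \<Longrightarrow> \<bar>q r\<bar> \<le> B"
    using compact_imp_bounded[OF compact_continuous_image[OF q compact_Icc]]
    unfolding bounded_iff by fastforce
  have "B \<ge> 0" using B[of s] st by auto
  have Q_bound: "\<bar>Q r\<bar> \<le> B" for r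
    using B[of r] \<open>B \<ge> 0\<close> by (auto simp: Q_def A_def indicator_def)
  have Q_cont: "isCont Q a" if "a \<in> A" for a
  proof -
    have "continuous_on A Q"
      using q_A by (rule continuous_on_eq) (simp add: Q_def)
    then show ?thesis
      using that by (auto simp: A_def continuous_on_eq_continuous_at)
  qed
  have cancel: "real (Suc n) * (inverse (real (Suc n)) * x) = x"
    "inverse (real (Suc n)) * (real (Suc n) * x) = x" for n x
    by (simp_all add: mult.assoc[symmetric] del: of_nat_Suc)
  \<comment> \<open>Substituting \<open>r = a + x / (n + 1)\<close> moves the concentration from the kernel to the argument of \<open>Q\<close>.\<close>
  have lim_q: "(\<lambda>n. \<integral>r. real (Suc n) * D 1 (real (Suc n) * (r - a)) * Q r \<partial>lborel) \<longlonglongrightarrow> q a"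
    if "a \<in> A" for a
  proof -
    have "(\<integral>r. real (Suc n) * D 1 (real (Suc n) * (r - a)) * Q r \<partial>lborel)
        = (\<integral>x. D 1 x * Q (a + inverse (real (Suc n)) * x) \<partial>lborel)" for n
      by (subst lborel_integral_real_affine[where c = "inverse (real (Suc n))" and t = a])
        (simp_all del: of_nat_Suc add: mult.assoc cancel)
    moreover have "(\<lambda>n. \<integral>x. D 1 x * Q (a + inverse (real (Suc n)) * x) \<partial>lborel)
        \<longlonglongrightarrow> (\<integral>x. D 1 x * Q a \<partial>lborel)"
    proof (rule integral_dominated_convergence[where w = "\<lambda>x. D 1 x * B"])
      show "integrable lborel (\<lambda>x. D 1 x * B)" using D1 by simp
      show "AE x in lborel. (\<lambda>n. D 1 x * Q (a + inverse (real (Suc n)) * x)) \<longlonglongrightarrow> D 1 x * Q a"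
      proof (intro always_eventually allI tendsto_mult tendsto_const)
        fix x :: real
        have "(\<lambda>n. a + inverse (real (Suc n)) * x) \<longlonglongrightarrow> a + 0 * x"
          by (intro tendsto_intros LIMSEQ_inverse_real_of_nat)
        then show "(\<lambda>n. Q (a + inverse (real (Suc n)) * x)) \<longlonglongrightarrow> Q a"
          using isCont_tendsto_compose[OF Q_cont[OF that]] by simp
      qed
      show "AE x in lborel. norm (D 1 x * Q (a + inverse (real (Suc n)) * x)) \<le> D 1 x * B" for n
        using nonneg Q_bound by (auto simp: abs_mult intro!: mult_left_mono)
    qed measurable
    ultimately show ?thesis using D1 that by (simp add: Q_def)
  qed
  have lim_D0: "(\<lambda>n. D 0 (real (Suc n) * (r - a))) \<longlonglongrightarrow> indicator {a..} r" if "r \<noteq> a" for r a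
  proof -
    obtain N where N: "1 / \<bar>r - a\<bar> < real N" using reals_Archimedean2 by blast
    have big: "real (Suc n) * \<bar>r - a\<bar> \<ge> 1" if "n \<ge> N" for n
    proof -
      have "1 / \<bar>r - a\<bar> < real (Suc n)" using N that by simp
      then show ?thesis using \<open>r \<noteq> a\<close> by (simp add: field_simps del: of_nat_Suc)
    qed
    have "D 0 (real (Suc n) * (r - a)) = indicator {a..} r" if "n \<ge> N" for n
    proof (cases "r > a")
      case True
      then show ?thesis using right[of "real (Suc n) * (r - a)"] big[OF that] by simp
    next
      case False
      then show ?thesis using left[of "real (Suc n) * (r - a)"] big[OF that] \<open>r \<noteq> a\<close>
        by (simp add: algebra_simps)
    qed
    then show ?thesis
      by (intro tendsto_eventually) (auto simp: eventually_sequentially)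
  qed
  define \<phi> where "\<phi> n r = D 0 (real (Suc n) * (r - s)) - D 0 (real (Suc n) * (r - t))" for n r
  have scaled: "((\<lambda>r. D k (c * (r - a))) has_real_derivative c * D (Suc k) (c * (r - a))) (at r)"
    for k c a r
    by (rule DERIV_chain'[OF _ D, THEN DERIV_cong]) (auto intro!: derivative_eq_intros)
  have deriv_\<phi>: "deriv (\<phi> n) r = real (Suc n) * D 1 (real (Suc n) * (r - s))
      - real (Suc n) * D 1 (real (Suc n) * (r - t))" for n r
    unfolding \<phi>_def[abs_def] using DERIV_diff[OF scaled[of 0] scaled[of 0]]
    by (intro DERIV_imp_deriv) (simp del: of_nat_Suc)
  obtain N where N: "1 / min s (T - t) < real N" using reals_Archimedean2 by blast
  \<comment> \<open>For large \<open>n\<close> the transition layers, of half-width \<open>1 / (n + 1)\<close>, lie inside \<open>(0, T)\<close>.\<close>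
  have test: "test_function T (\<phi> n)" if "n \<ge> N" for n
  proof -
    define c where "c = real (Suc n)"
    have c: "c > 0" "1 / min s (T - t) < c" using N that by (auto simp: c_def)
    have "min s (T - t) > 0" using st by simp
    then have "1 / c < min s (T - t)" using c by (simp add: field_simps del: min_less_iff_conj)
    then have c': "1 / c < s" "1 / c < T - t" by auto
    define E where "E k r = c ^ k * (D k (c * (r - s)) - D k (c * (r - t)))" for k r
    have "(E k has_real_derivative E (Suc k) r) (at r)" for k r
      unfolding E_def[abs_def]
      by (rule DERIV_cmult[OF DERIV_diff[OF scaled scaled], THEN DERIV_cong])
        (simp add: algebra_simps)
    moreover have "E 0 = \<phi> n" by (simp add: E_def[abs_def] \<phi>_def[abs_def] c_def)
    moreover have "{s - 1 / c..t + 1 / c} \<subseteq> {0<..<T}" using c' by auto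
    moreover have "\<phi> n r = 0" if "r \<notin> {s - 1 / c..t + 1 / c}" for r
    proof (cases "r < s - 1 / c")
      case True
      then have "c * (r - s) \<le> -1" "c * (r - t) \<le> -1"
        using c st mult_left_mono[of "r - s" "- (1 / c)" c] mult_left_mono[of "r - t" "- (1 / c)" c]
        by auto
      then show ?thesis by (simp add: \<phi>_def c_def[symmetric] left del: of_nat_Suc)
    next
      case False
      then have "c * (r - s) \<ge> 1" "c * (r - t) \<ge> 1"
        using c st that mult_left_mono[of "1 / c" "r - s" c] mult_left_mono[of "1 / c" "r - t" c]
        by auto
      then show ?thesis by (simp add: \<phi>_def c_def[symmetric] right del: of_nat_Suc)
    qed
    ultimately show ?thesis unfolding test_function_def by (metis compact_Icc)
  qed
  have int: "integrable lborel (\<lambda>r. real (Suc n) * D 1 (real (Suc n) * (r - a)) * Q r)" for n a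
  proof (rule Bochner_Integration.integrable_bound)
    show "integrable lborel (\<lambda>r. B * (real (Suc n) * D 1 (- (real (Suc n) * a) + real (Suc n) * r)))"
      by (intro integrable_mult_right lborel_integrable_real_affine D1) simp
    show "AE r in lborel. norm (real (Suc n) * D 1 (real (Suc n) * (r - a)) * Q r)
        \<le> norm (B * (real (Suc n) * D 1 (- (real (Suc n) * a) + real (Suc n) * r)))"
      using Q_bound \<open>B \<ge> 0\<close> nonneg
      by (intro always_eventually allI)
        (auto simp: abs_mult algebra_simps simp del: of_nat_Suc intro!: mult_mono)
  qed measurable
  have "(\<lambda>n. LINT r:A|lborel. deriv (\<phi> n) r * q r) \<longlonglongrightarrow> q s - q t"
  proof -
    have "(LINT r:A|lborel. deriv (\<phi> n) r * q r) =
        (\<integral>r. real (Suc n) * D 1 (real (Suc n) * (r - s)) * Q r \<partial>lborel)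
        - (\<integral>r. real (Suc n) * D 1 (real (Suc n) * (r - t)) * Q r \<partial>lborel)" for n
      unfolding set_lebesgue_integral_def
      by (subst Bochner_Integration.integral_diff[OF int int, symmetric])
        (auto intro!: Bochner_Integration.integral_cong simp: deriv_\<phi> Q_def algebra_simps)
    then show ?thesis using lim_q[of s] lim_q[of t] st by (auto simp: A_def intro: tendsto_diff)
  qed
  moreover have "(\<lambda>n. LINT r:A|lborel. deriv (\<phi> n) r * q r) \<longlonglongrightarrow> - (LINT r:{s..t}|lborel. p r)"
  proof (rule Lim_transform_eventually)
    show "\<forall>\<^sub>F n in sequentially. - (\<integral>r. \<phi> n r * P r \<partial>lborel)
        = (LINT r:A|lborel. deriv (\<phi> n) r * q r)"
      using weak[OF test] unfolding eventually_sequentially A_def[symmetric]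
      by (intro exI[of _ N]) (auto simp: P_def set_lebesgue_integral_def ac_simps)
    have "(\<lambda>n. \<integral>r. \<phi> n r * P r \<partial>lborel) \<longlonglongrightarrow> (\<integral>r. indicator {s..t} r * P r \<partial>lborel)"
    proof (rule integral_dominated_convergence[where w = "\<lambda>r. \<bar>P r\<bar>"])
      show "AE r in lborel. norm (\<phi> n r * P r) \<le> \<bar>P r\<bar>" for n
      proof -
        have "\<bar>\<phi> n r\<bar> \<le> 1" for r
          using D0[of "real (Suc n) * (r - s)"] D0[of "real (Suc n) * (r - t)"]
          unfolding \<phi>_def by linarith
        then show ?thesis by (auto simp: abs_mult intro!: AE_I2 mult_left_le_one_le)
      qed
      show "AE r in lborel. (\<lambda>n. \<phi> n r * P r) \<longlonglongrightarrow> indicator {s..t} r * P r"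
        using AE_lborel_singleton[of s] AE_lborel_singleton[of t]
      proof eventually_elim
        case (elim r)
        have "(\<lambda>n. \<phi> n r * P r) \<longlonglongrightarrow> (indicator {s..} r - indicator {t..} r) * P r"
          unfolding \<phi>_def by (intro tendsto_intros lim_D0 elim)
        then show ?case using elim st by (auto simp: indicator_def split: if_splits)
      qed
    qed (use P in \<open>auto simp: \<phi>_def[abs_def]\<close>)
    moreover have "(\<integral>r. indicator {s..t} r * P r \<partial>lborel) = (LINT r:{s..t}|lborel. p r)"
      unfolding set_lebesgue_integral_def P_def using st
      by (intro Bochner_Integration.integral_cong) (auto simp: A_def indicator_def)
    ultimately show "(\<lambda>n. - (\<integral>r. \<phi> n r * P r \<partial>lborel)) \<longlonglongrightarrow> - (LINT r:{s..t}|lborel. p r)"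
      by (auto intro: tendsto_minus)
  qed
  ultimately show ?thesis using LIMSEQ_unique by fastforce
qed

section \<open>Square-integrable functions\<close>

definition L2_norm :: "'a measure \<Rightarrow> ('a \<Rightarrow> real) \<Rightarrow> real" where
  "L2_norm \<nu> f = sqrt (\<integral>x. (f x)\<^sup>2 \<partial>\<nu>)"

lemma L2_iff: "f \<in> Lp_space 2 \<nu> \<longleftrightarrow> f \<in> borel_measurable \<nu> \<and> integrable \<nu> (\<lambda>x. (f x)\<^sup>2)"
  and Lp_norm_2_eq: "f \<in> Lp_space 2 \<nu> \<Longrightarrow> Lp_norm 2 \<nu> f = ennreal (L2_norm \<nu> f)"
proof -
  have I: "(\<integral>\<^sup>+x. ennreal (\<bar>f x\<bar> powr 2) \<partial>\<nu>) = (\<integral>\<^sup>+x. ennreal ((f x)\<^sup>2) \<partial>\<nu>)"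
    by (intro nn_integral_cong) (simp add: powr_numeral)
  show iff: "f \<in> Lp_space 2 \<nu> \<longleftrightarrow> f \<in> borel_measurable \<nu> \<and> integrable \<nu> (\<lambda>x. (f x)\<^sup>2)"
    unfolding Lp_space_def Lp_norm_def Let_def I
    by (auto simp: integrable_iff_bounded less_top)
  assume "f \<in> Lp_space 2 \<nu>"
  then show "Lp_norm 2 \<nu> f = ennreal (L2_norm \<nu> f)"
    unfolding iff Lp_norm_def I
    by (simp add: nn_integral_eq_integral L2_norm_def powr_half_sqrt)
qed

lemma L2_measurable: "f \<in> Lp_space 2 \<nu> \<Longrightarrow> f \<in> borel_measurable \<nu>"
  by (simp add: L2_iff)

lemma L2_mult_integrable:
  assumes "f \<in> Lp_space 2 \<nu>" "g \<in> Lp_space 2 \<nu>"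
  shows "integrable \<nu> (\<lambda>x. f x * g x)"
proof (rule Bochner_Integration.integrable_bound)
  show "integrable \<nu> (\<lambda>x. (f x)\<^sup>2 + (g x)\<^sup>2)" using assms by (simp add: L2_iff)
  show "(\<lambda>x. f x * g x) \<in> borel_measurable \<nu>"
    using assms by (intro borel_measurable_times L2_measurable)
  have "\<bar>f x * g x\<bar> \<le> (f x)\<^sup>2 + (g x)\<^sup>2" for x
  proof -
    have "2 * \<bar>f x * g x\<bar> \<le> (f x)\<^sup>2 + (g x)\<^sup>2"
      using sum_squares_bound[of "\<bar>f x\<bar>" "\<bar>g x\<bar>"] by (simp add: abs_mult mult.assoc)
    then show ?thesis using abs_ge_zero[of "f x * g x"] by linarith
  qed
  then show "AE x in \<nu>. norm (f x * g x) \<le> norm ((f x)\<^sup>2 + (g x)\<^sup>2)" by auto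
qed

lemma L2_lincomb:
  assumes f: "f \<in> Lp_space 2 \<nu>" and g: "g \<in> Lp_space 2 \<nu>"
  shows "(\<lambda>x. a * f x + b * g x) \<in> Lp_space 2 \<nu>"
proof -
  have "integrable \<nu> (\<lambda>x. a\<^sup>2 * (f x)\<^sup>2 + 2 * a * b * (f x * g x) + b\<^sup>2 * (g x)\<^sup>2)"
    using f g L2_mult_integrable[OF f g] by (simp add: L2_iff)
  moreover have "(\<lambda>x. a\<^sup>2 * (f x)\<^sup>2 + 2 * a * b * (f x * g x) + b\<^sup>2 * (g x)\<^sup>2)
      = (\<lambda>x. (a * f x + b * g x)\<^sup>2)"
    by (simp add: fun_eq_iff power2_eq_square algebra_simps)
  moreover have "(\<lambda>x. a * f x + b * g x) \<in> borel_measurable \<nu>"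
    using f g by (intro borel_measurable_add borel_measurable_times borel_measurable_const L2_measurable)
  ultimately show ?thesis by (simp add: L2_iff)
qed

lemma L2_diff:
  "f \<in> Lp_space 2 \<nu> \<Longrightarrow> g \<in> Lp_space 2 \<nu> \<Longrightarrow> (\<lambda>x. f x - g x) \<in> Lp_space 2 \<nu>"
  using L2_lincomb[of f \<nu> g 1 "-1"] by simp

lemma L2_scale: "f \<in> Lp_space 2 \<nu> \<Longrightarrow> (\<lambda>x. c * f x) \<in> Lp_space 2 \<nu>"
  using L2_lincomb[of f \<nu> f c 0] by simp

lemma L2_uminus: "f \<in> Lp_space 2 \<nu> \<Longrightarrow> (\<lambda>x. - f x) \<in> Lp_space 2 \<nu>"
  using L2_scale[of f \<nu> "-1"] by simp

lemma L2_const: "finite_measure \<nu> \<Longrightarrow> (\<lambda>x. c) \<in> Lp_space 2 \<nu>"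
  by (simp add: L2_iff finite_measure.integrable_const)

lemma L2_norm_nonneg [simp]: "L2_norm \<nu> f \<ge> 0"
  by (simp add: L2_norm_def)

lemma L2_norm_power2: "(L2_norm \<nu> f)\<^sup>2 = (\<integral>x. f x * f x \<partial>\<nu>)"
  by (simp add: L2_norm_def power2_eq_square[symmetric])

lemma L2_norm_eq_0_iff:
  "f \<in> Lp_space 2 \<nu> \<Longrightarrow> L2_norm \<nu> f = 0 \<longleftrightarrow> (AE x in \<nu>. f x = 0)"
  by (simp add: L2_norm_def L2_iff integral_nonneg_eq_0_iff_AE)

lemma L2_norm_minus_commute: "L2_norm \<nu> (\<lambda>x. f x - g x) = L2_norm \<nu> (\<lambda>x. g x - f x)"
  by (simp add: L2_norm_def power2_commute)

lemma L2_Cauchy_Schwarz: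
  assumes f: "f \<in> Lp_space 2 \<nu>" and g: "g \<in> Lp_space 2 \<nu>"
  shows "(\<integral>x. f x * g x \<partial>\<nu>) \<le> L2_norm \<nu> f * L2_norm \<nu> g"
proof (cases "L2_norm \<nu> f = 0 \<or> L2_norm \<nu> g = 0")
  case True
  then have "AE x in \<nu>. f x * g x = 0"
    using f g by (auto simp: L2_norm_eq_0_iff)
  then have "(\<integral>x. f x * g x \<partial>\<nu>) = 0" by (rule integral_eq_zero_AE)
  then show ?thesis by simp
next
  case False
  define a b where "a = L2_norm \<nu> f" and "b = L2_norm \<nu> g"
  have pos: "a > 0" "b > 0"
    using False L2_norm_nonneg[of \<nu> f] L2_norm_nonneg[of \<nu> g] unfolding a_def b_def by linarith+
  have "0 \<le> (\<integral>x. (b * f x - a * g x) * (b * f x - a * g x) \<partial>\<nu>)" by simp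
  also have "\<dots> = (\<integral>x. b\<^sup>2 * (f x * f x) - 2 * a * b * (f x * g x) + a\<^sup>2 * (g x * g x) \<partial>\<nu>)"
    by (intro Bochner_Integration.integral_cong) (auto simp: power2_eq_square algebra_simps)
  also have "\<dots> = b\<^sup>2 * a\<^sup>2 - 2 * a * b * (\<integral>x. f x * g x \<partial>\<nu>) + a\<^sup>2 * b\<^sup>2"
    using L2_mult_integrable[OF f g] L2_mult_integrable[OF f f] L2_mult_integrable[OF g g]
    by (simp add: a_def b_def L2_norm_power2)
  finally have "(2 * a * b) * (\<integral>x. f x * g x \<partial>\<nu>) \<le> (2 * a * b) * (a * b)"
    by (simp add: power2_eq_square algebra_simps)
  then show ?thesis using pos by (simp add: a_def b_def)
qed

lemma L2_Cauchy_Schwarz_abs: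
  assumes f: "f \<in> Lp_space 2 \<nu>" and g: "g \<in> Lp_space 2 \<nu>"
  shows "\<bar>\<integral>x. f x * g x \<partial>\<nu>\<bar> \<le> L2_norm \<nu> f * L2_norm \<nu> g"
proof -
  have "L2_norm \<nu> (\<lambda>x. - f x) = L2_norm \<nu> f" by (simp add: L2_norm_def)
  then show ?thesis
    using L2_Cauchy_Schwarz[OF f g] L2_Cauchy_Schwarz[OF L2_uminus[OF f] g] by simp
qed

lemma L2_norm_triangle:
  assumes f: "f \<in> Lp_space 2 \<nu>" and g: "g \<in> Lp_space 2 \<nu>"
  shows "L2_norm \<nu> f \<le> L2_norm \<nu> g + L2_norm \<nu> (\<lambda>x. f x - g x)"
proof -
  define h where "h = (\<lambda>x. f x - g x)"
  have h: "h \<in> Lp_space 2 \<nu>" unfolding h_def by (rule L2_diff[OF f g])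
  have "(L2_norm \<nu> f)\<^sup>2 = (\<integral>x. g x * g x + 2 * (g x * h x) + h x * h x \<partial>\<nu>)"
    unfolding L2_norm_power2 h_def
    by (intro Bochner_Integration.integral_cong) (auto simp: algebra_simps)
  also have "\<dots> = (L2_norm \<nu> g)\<^sup>2 + 2 * (\<integral>x. g x * h x \<partial>\<nu>) + (L2_norm \<nu> h)\<^sup>2"
    using L2_mult_integrable[OF g g] L2_mult_integrable[OF g h] L2_mult_integrable[OF h h]
    by (simp add: L2_norm_power2)
  also have "\<dots> \<le> (L2_norm \<nu> g + L2_norm \<nu> h)\<^sup>2"
    using L2_Cauchy_Schwarz[OF g h] by (simp add: power2_eq_square algebra_simps)
  finally have "L2_norm \<nu> f \<le> L2_norm \<nu> g + L2_norm \<nu> h"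
    by (rule power2_le_imp_le) simp
  then show ?thesis by (simp add: h_def)
qed

lemma L2_norm_diff_abs:
  assumes "f \<in> Lp_space 2 \<nu>" "g \<in> Lp_space 2 \<nu>"
  shows "\<bar>L2_norm \<nu> f - L2_norm \<nu> g\<bar> \<le> L2_norm \<nu> (\<lambda>x. f x - g x)"
  using L2_norm_triangle[OF assms] L2_norm_triangle[OF assms(2,1)]
  by (simp add: L2_norm_minus_commute[of \<nu> g f])

lemma L2_pairing_lipschitz:
  assumes "f \<in> Lp_space 2 \<nu>" "g \<in> Lp_space 2 \<nu>" "h \<in> Lp_space 2 \<nu>"
  shows "\<bar>(\<integral>x. f x * h x \<partial>\<nu>) - (\<integral>x. g x * h x \<partial>\<nu>)\<bar>
    \<le> L2_norm \<nu> h * L2_norm \<nu> (\<lambda>x. f x - g x)"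
proof -
  have "(\<integral>x. (f x - g x) * h x \<partial>\<nu>) = (\<integral>x. f x * h x \<partial>\<nu>) - (\<integral>x. g x * h x \<partial>\<nu>)"
    using L2_mult_integrable[OF assms(1,3)] L2_mult_integrable[OF assms(2,3)]
    by (simp add: left_diff_distrib)
  then show ?thesis
    using L2_Cauchy_Schwarz_abs[OF L2_diff[OF assms(1,2)] assms(3)] by (simp add: mult.commute)
qed

lemma L2_imp_L1:
  assumes "finite_measure \<nu>" "f \<in> Lp_space 2 \<nu>"
  shows "integrable \<nu> f" and "f \<in> Lp_space 1 \<nu>"
proof -
  show i: "integrable \<nu> f"
    using L2_mult_integrable[OF assms(2) L2_const[OF assms(1), of 1]] by simp
  have "(\<integral>\<^sup>+x. ennreal (\<bar>f x\<bar> powr 1) \<partial>\<nu>) < \<infinity>"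
    using i by (simp add: integrable_iff_bounded)
  then show "f \<in> Lp_space 1 \<nu>"
    using i by (auto simp: Lp_space_def Lp_norm_def Let_def)
qed

section \<open>Scalar functions from vector-valued ones\<close>

lemma L2_simple_functional_measurable:
  fixes F :: "('a \<Rightarrow> real) \<Rightarrow> real"
  assumes "L2_simple M \<nu> s"
  shows "(\<lambda>t. F (s t)) \<in> borel_measurable M"
proof -
  have "simple_function M s" using assms by (simp add: L2_simple_def)
  then have "simple_function M (\<lambda>t. F (s t))" by (rule simple_function_compose1)
  then show ?thesis by (rule borel_measurable_simple_function)
qed

text \<open>The approximating simple functions converge only almost everywhere, so \<open>t \<mapsto> F (f t)\<close> agrees
  with a measurable function only up to a null set. The functionals of interest are the norm and the
  inner product with a fixed element.\<close>

lemma strongly_measurable_functional: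
  fixes F :: "('a \<Rightarrow> real) \<Rightarrow> real"
  assumes f: "L2_strongly_measurable M \<nu> f"
    and lipschitz: "\<And>f g. f \<in> Lp_space 2 \<nu> \<Longrightarrow> g \<in> Lp_space 2 \<nu> \<Longrightarrow>
      \<bar>F f - F g\<bar> \<le> C * L2_norm \<nu> (\<lambda>x. f x - g x)"
  obtains p where "p \<in> borel_measurable M" and "AE t in M. p t = F (f t)"
proof -
  obtain s where s: "\<And>i. L2_simple M \<nu> (s i)"
    and lim: "AE t in M. (\<lambda>i. Lp_norm 2 \<nu> (\<lambda>x. f t x - s i t x)) \<longlonglongrightarrow> 0"
    using f unfolding L2_strongly_measurable_def by blast
  have fL2: "f t \<in> Lp_space 2 \<nu>" if "t \<in> space M" for t
    using f that unfolding L2_strongly_measurable_def by blast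
  have sL2: "s i t \<in> Lp_space 2 \<nu>" if "t \<in> space M" for i t
    using s[of i] that unfolding L2_simple_def by blast
  show thesis
  proof
    show "(\<lambda>t. lim (\<lambda>i. F (s i t))) \<in> borel_measurable M"
      by (intro borel_measurable_lim_metric L2_simple_functional_measurable[OF s, where F = F])
    show "AE t in M. lim (\<lambda>i. F (s i t)) = F (f t)"
      using lim AE_space
    proof eventually_elim
      case (elim t)
      have "Lp_norm 2 \<nu> (\<lambda>x. f t x - s i t x) = ennreal (L2_norm \<nu> (\<lambda>x. f t x - s i t x))" for i
        using elim(2) by (intro Lp_norm_2_eq L2_diff fL2 sL2)
      then have "(\<lambda>i. L2_norm \<nu> (\<lambda>x. f t x - s i t x)) \<longlonglongrightarrow> 0"
        using elim(1) by (simp only: ennreal_tendsto_0_iff L2_norm_nonneg)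
      then have "(\<lambda>i. C * L2_norm \<nu> (\<lambda>x. f t x - s i t x)) \<longlonglongrightarrow> 0"
        by (rule tendsto_mult_right_zero)
      then have "(\<lambda>i. F (s i t) - F (f t)) \<longlonglongrightarrow> 0"
      proof (rule Lim_null_comparison[rotated])
        show "\<forall>\<^sub>F i in sequentially. norm (F (s i t) - F (f t))
            \<le> C * L2_norm \<nu> (\<lambda>x. f t x - s i t x)"
          using lipschitz[OF fL2[OF elim(2)] sL2[OF elim(2)]]
          by (intro always_eventually allI) (simp add: abs_minus_commute)
      qed
      then show ?case by (intro limI) (rule LIM_zero_cancel)
    qed
  qed
qed

lemma L2_sum:
  assumes "finite I" "\<And>i. i \<in> I \<Longrightarrow> f i \<in> Lp_space 2 \<nu>"
  shows "(\<lambda>x. \<Sum>i\<in>I. c i * f i x) \<in> Lp_space 2 \<nu>"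
  using assms
proof (induction I rule: finite_induct)
  case empty
  then show ?case by (simp add: L2_iff)
next
  case (insert i I)
  then have "(\<lambda>x. c i * f i x + 1 * (\<Sum>i\<in>I. c i * f i x)) \<in> Lp_space 2 \<nu>"
    by (intro L2_lincomb) auto
  then show ?case using insert by simp
qed

lemma L2_simple_integral_in_L2:
  assumes "L2_simple M \<nu> s"
  shows "L2_simple_integral M s \<in> Lp_space 2 \<nu>"
  using assms unfolding L2_simple_def L2_simple_integral_def[abs_def]
  by (intro L2_sum) (auto dest: simple_functionD(1))

lemma L2_simple_integral_pairing:
  assumes M: "finite_measure M" and s: "L2_simple M \<nu> s" and h: "h \<in> Lp_space 2 \<nu>"
  shows "has_bochner_integral M (\<lambda>t. \<integral>x. s t x * h x \<partial>\<nu>) (\<integral>x. L2_simple_integral M s x * h x \<partial>\<nu>)"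
proof -
  interpret finite_measure M by (rule M)
  define I where "I = s ` space M"
  define E where "E g = {t \<in> space M. s t = g}" for g
  have simple: "simple_function M s" using s by (simp add: L2_simple_def)
  have fin: "finite I" unfolding I_def by (rule simple_functionD(1)[OF simple])
  have E: "E g \<in> sets M" for g
  proof -
    have "E g = s -` {g} \<inter> space M" by (auto simp: E_def)
    then show ?thesis using simple_functionD(2)[OF simple, of "{g}"] by simp
  qed
  have L2: "g \<in> I \<Longrightarrow> g \<in> Lp_space 2 \<nu>" for g
    using s by (auto simp: L2_simple_def I_def)
  have "has_bochner_integral M (\<lambda>t. \<Sum>g\<in>I. indicator (E g) t * (\<integral>x. g x * h x \<partial>\<nu>))
      (\<Sum>g\<in>I. measure M (E g) * (\<integral>x. g x * h x \<partial>\<nu>))"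
    by (intro has_bochner_integral_sum has_bochner_integral_mult_left
        has_bochner_integral_real_indicator E) (auto simp: less_top[symmetric])
  moreover have "(\<Sum>g\<in>I. indicator (E g) t * (\<integral>x. g x * h x \<partial>\<nu>)) = (\<integral>x. s t x * h x \<partial>\<nu>)"
    if "t \<in> space M" for t
  proof -
    have "(\<Sum>g\<in>I. indicator (E g) t * (\<integral>x. g x * h x \<partial>\<nu>))
        = (\<Sum>g\<in>I. if g = s t then (\<integral>x. g x * h x \<partial>\<nu>) else 0)"
      using that by (intro sum.cong) (auto simp: E_def)
    then show ?thesis using that fin by (simp add: I_def)
  qed
  moreover have "(\<Sum>g\<in>I. measure M (E g) * (\<integral>x. g x * h x \<partial>\<nu>))
      = (\<integral>x. L2_simple_integral M s x * h x \<partial>\<nu>)"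
  proof -
    have "(\<integral>x. L2_simple_integral M s x * h x \<partial>\<nu>)
        = (\<integral>x. (\<Sum>g\<in>I. measure M (E g) * (g x * h x)) \<partial>\<nu>)"
      by (intro Bochner_Integration.integral_cong)
        (auto simp: L2_simple_integral_def I_def E_def sum_distrib_right mult.assoc)
    also have "\<dots> = (\<Sum>g\<in>I. measure M (E g) * (\<integral>x. g x * h x \<partial>\<nu>))"
      using L2_mult_integrable[OF L2 h] by simp
    finally show ?thesis by simp
  qed
  ultimately show ?thesis
    by (simp cong: has_bochner_integral_cong)
qed

text \<open>A bounded functional commutes with the Bochner integral: this holds for simple functions, and the
  error of the approximation is controlled in norm. The scalar function is passed as a separate
  \<open>p\<close> because \<open>t \<mapsto> \<langle>f t, h\<rangle>\<close> itself may fail to be measurable on a null set.\<close>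

lemma has_L2_integral_pairing:
  assumes M: "finite_measure M" and f: "has_L2_integral M \<nu> f g" and h: "h \<in> Lp_space 2 \<nu>"
    and p: "integrable M p" and p_eq: "AE t in M. p t = (\<integral>x. f t x * h x \<partial>\<nu>)"
  shows "(\<integral>t. p t \<partial>M) = (\<integral>x. g x * h x \<partial>\<nu>)"
proof -
  obtain s where s: "\<And>i. L2_simple M \<nu> (s i)"
    and lim1: "(\<lambda>i. \<integral>\<^sup>+t. Lp_norm 2 \<nu> (\<lambda>x. f t x - s i t x) \<partial>M) \<longlonglongrightarrow> 0"
    and lim2: "(\<lambda>i. Lp_norm 2 \<nu> (\<lambda>x. L2_simple_integral M (s i) x - g x)) \<longlonglongrightarrow> 0"
    and g: "g \<in> Lp_space 2 \<nu>"
    and fL2: "\<And>t. t \<in> space M \<Longrightarrow> f t \<in> Lp_space 2 \<nu>"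
    using f unfolding has_L2_integral_def L2_strongly_measurable_def by blast
  have sL2: "s i t \<in> Lp_space 2 \<nu>" if "t \<in> space M" for i t
    using s[of i] that unfolding L2_simple_def by blast
  define S where "S i = (\<integral>x. L2_simple_integral M (s i) x * h x \<partial>\<nu>)" for i
  \<comment> \<open>The factor is divided out before integrating, since \<open>t \<mapsto> \<parallel>f t - s t\<parallel>\<close> need not be
      measurable and constants cannot be moved out of its integral. Adding 1 keeps it positive.\<close>
  define c where "c = 1 + L2_norm \<nu> h"
  have c: "c > 0" "L2_norm \<nu> h \<le> c"
    using L2_norm_nonneg[of \<nu> h] by (simp_all add: c_def del: L2_norm_nonneg)
  define r where "r i t = (p t - (\<integral>x. s i t x * h x \<partial>\<nu>)) / c" for i t
  have r: "has_bochner_integral M (r i) (((\<integral>t. p t \<partial>M) - S i) / c)" for i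
    unfolding r_def[abs_def] S_def using p
    by (intro has_bochner_integral_divide_zero has_bochner_integral_diff
        L2_simple_integral_pairing[OF M s h]) (simp add: has_bochner_integral_iff)
  have "(\<lambda>i. ennreal (norm (((\<integral>t. p t \<partial>M) - S i) / c))) \<longlonglongrightarrow> 0"
  proof (rule tendsto_sandwich[OF _ _ tendsto_const lim1])
    show "\<forall>\<^sub>F i in sequentially. ennreal (norm (((\<integral>t. p t \<partial>M) - S i) / c))
        \<le> (\<integral>\<^sup>+t. Lp_norm 2 \<nu> (\<lambda>x. f t x - s i t x) \<partial>M)"
    proof (intro always_eventually allI)
      fix i
      have "ennreal (norm (((\<integral>t. p t \<partial>M) - S i) / c)) \<le> (\<integral>\<^sup>+t. ennreal (norm (r i t)) \<partial>M)"
        using integral_norm_bound_ennreal[of M "r i"] r[of i]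
        by (simp add: has_bochner_integral_iff)
      also have "\<dots> \<le> (\<integral>\<^sup>+t. Lp_norm 2 \<nu> (\<lambda>x. f t x - s i t x) \<partial>M)"
      proof (rule nn_integral_mono_AE)
        show "AE t in M. ennreal (norm (r i t)) \<le> Lp_norm 2 \<nu> (\<lambda>x. f t x - s i t x)"
          using p_eq AE_space
        proof eventually_elim
          case (elim t)
          have "c * norm (r i t) \<le> L2_norm \<nu> h * L2_norm \<nu> (\<lambda>x. f t x - s i t x)"
            using L2_pairing_lipschitz[OF fL2 sL2 h, of t t i] elim c by (simp add: r_def)
          also have "\<dots> \<le> c * L2_norm \<nu> (\<lambda>x. f t x - s i t x)"
            using c by (intro mult_right_mono) auto
          finally have "norm (r i t) \<le> L2_norm \<nu> (\<lambda>x. f t x - s i t x)"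
            using c by simp
          then show ?case using elim by (simp add: Lp_norm_2_eq L2_diff fL2 sL2 ennreal_leI)
        qed
      qed
      finally show "ennreal (norm (((\<integral>t. p t \<partial>M) - S i) / c))
        \<le> (\<integral>\<^sup>+t. Lp_norm 2 \<nu> (\<lambda>x. f t x - s i t x) \<partial>M)" .
    qed
  qed simp
  then have "(\<lambda>i. norm (((\<integral>t. p t \<partial>M) - S i) / c)) \<longlonglongrightarrow> 0"
    by (simp only: ennreal_tendsto_0_iff norm_ge_zero)
  then have "(\<lambda>i. ((\<integral>t. p t \<partial>M) - S i) / c) \<longlonglongrightarrow> 0"
    by (rule tendsto_norm_zero_cancel)
  from tendsto_mult_right_zero[OF this, of c] have "(\<lambda>i. (\<integral>t. p t \<partial>M) - S i) \<longlonglongrightarrow> 0"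
    using c by simp
  from tendsto_diff[OF tendsto_const[of "\<integral>t. p t \<partial>M"] this]
  have "S \<longlonglongrightarrow> (\<integral>t. p t \<partial>M)"
    by simp
  moreover have "S \<longlonglongrightarrow> (\<integral>x. g x * h x \<partial>\<nu>)"
  proof -
    note S_L2 = L2_simple_integral_in_L2[OF s]
    have "(\<lambda>i. L2_norm \<nu> (\<lambda>x. L2_simple_integral M (s i) x - g x)) \<longlonglongrightarrow> 0"
      using lim2 by (simp add: Lp_norm_2_eq L2_diff S_L2 g ennreal_tendsto_0_iff)
    then have "(\<lambda>i. L2_norm \<nu> h * L2_norm \<nu> (\<lambda>x. L2_simple_integral M (s i) x - g x)) \<longlonglongrightarrow> 0"
      by (rule tendsto_mult_right_zero)
    then have "(\<lambda>i. S i - (\<integral>x. g x * h x \<partial>\<nu>)) \<longlonglongrightarrow> 0"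
      by (rule Lim_null_comparison[rotated])
        (use L2_pairing_lipschitz[OF S_L2 g h] in \<open>auto simp: S_def\<close>)
    then show ?thesis by (rule LIM_zero_cancel)
  qed
  ultimately show ?thesis by (rule LIMSEQ_unique)
qed

lemma W11_norm_integrable:
  assumes "W11_derivative T \<nu> u v"
  obtains G where "set_integrable lborel {0<..<T} G"
    and "AE t in lborel. t \<in> {0<..<T} \<longrightarrow> G t = L2_norm \<nu> (v t)"
proof -
  define M where "M = restrict_space lborel {0<..<T}"
  have v: "L2_integrable M \<nu> v"
    using assms by (simp add: W11_derivative_def Let_def M_def)
  then have meas: "L2_strongly_measurable M \<nu> v"
    and finite: "(\<integral>\<^sup>+t. Lp_norm 2 \<nu> (v t) \<partial>M) < \<infinity>"
    by (simp_all add: L2_integrable_def)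
  obtain G where G: "G \<in> borel_measurable M" "AE t in M. G t = L2_norm \<nu> (v t)"
    by (rule strongly_measurable_functional[OF meas, of "L2_norm \<nu>" 1])
      (simp_all add: L2_norm_diff_abs)
  have "AE t in M. ennreal (norm (G t)) = Lp_norm 2 \<nu> (v t)"
    using G(2) AE_space
  proof eventually_elim
    case (elim t)
    then have "v t \<in> Lp_space 2 \<nu>" using meas by (simp add: L2_strongly_measurable_def)
    then show ?case using elim by (simp add: Lp_norm_2_eq)
  qed
  then have "(\<integral>\<^sup>+t. ennreal (norm (G t)) \<partial>M) < \<infinity>"
    using finite by (simp cong: nn_integral_cong_AE)
  then have "integrable M G" using G(1) by (rule integrableI_bounded[rotated])
  then show thesis using G(2) unfolding M_def
    by (intro that) (simp_all add: set_integrable_def integrable_restrict_space AE_restrict_space_iff)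
qed

text \<open>Pairing the vector-valued weak derivative with a fixed \<open>h\<close> gives a scalar weak derivative, to
  which the scalar fundamental theorem applies. The function \<open>p\<close> is a measurable version of
  \<open>t \<mapsto> \<langle>v t, h\<rangle>\<close>.\<close>

lemma W11_pairing_FTC:
  assumes W: "W11_derivative T \<nu> u v" and h: "h \<in> Lp_space 2 \<nu>"
    and cont: "continuous_on {0..T} (\<lambda>t. \<integral>x. u t x * h x \<partial>\<nu>)"
  shows "\<exists>p. set_integrable lborel {0<..<T} p \<and>
    (AE t in lborel. t \<in> {0<..<T} \<longrightarrow> p t = (\<integral>x. v t x * h x \<partial>\<nu>)) \<and>
    (\<forall>s t. 0 < s \<longrightarrow> s < t \<longrightarrow> t < T \<longrightarrow>
      (\<integral>x. u t x * h x \<partial>\<nu>) - (\<integral>x. u s x * h x \<partial>\<nu>) = (LINT r:{s..t}|lborel. p r))"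
proof -
  define M where "M = restrict_space lborel {0<..<T}"
  have fin: "finite_measure M"
    by (rule finite_measureI, cases "0 \<le> T")
      (simp_all add: M_def space_restrict_space emeasure_restrict_space)
  define q where "q t = (\<integral>x. u t x * h x \<partial>\<nu>)" for t
  have meas: "L2_strongly_measurable M \<nu> v"
    and weak: "\<And>\<phi>. test_function T \<phi> \<Longrightarrow> \<exists>g. has_L2_integral M \<nu> (\<lambda>t x. deriv \<phi> t * u t x) g \<and>
        has_L2_integral M \<nu> (\<lambda>t x. \<phi> t * v t x) (\<lambda>x. - g x)"
    using W by (simp_all add: W11_derivative_def Let_def M_def L2_integrable_def)
  have vL2: "v t \<in> Lp_space 2 \<nu>" if "t \<in> {0<..<T}" for t
    using meas that by (simp add: L2_strongly_measurable_def M_def space_restrict_space)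
  obtain p where p: "p \<in> borel_measurable M" "AE t in M. p t = (\<integral>x. v t x * h x \<partial>\<nu>)"
    by (rule strongly_measurable_functional[OF meas, of "\<lambda>f. \<integral>x. f x * h x \<partial>\<nu>" "L2_norm \<nu> h"])
      (simp_all add: L2_pairing_lipschitz[OF _ _ h])
  obtain G where G: "set_integrable lborel {0<..<T} G"
    "AE t in lborel. t \<in> {0<..<T} \<longrightarrow> G t = L2_norm \<nu> (v t)"
    using W11_norm_integrable[OF W] by blast
  then have GM: "integrable M G" "AE t in M. G t = L2_norm \<nu> (v t)"
    unfolding M_def
    by (simp_all add: set_integrable_def integrable_restrict_space AE_restrict_space_iff)
  have pM: "integrable M p"
  proof (rule Bochner_Integration.integrable_bound)
    show "integrable M (\<lambda>t. L2_norm \<nu> h * G t)" using GM by simp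
    show "AE t in M. norm (p t) \<le> norm (L2_norm \<nu> h * G t)"
      using p(2) GM(2) AE_space
    proof eventually_elim
      case (elim t)
      then show ?case
        using L2_Cauchy_Schwarz_abs[OF vL2 h, of t]
        by (simp add: M_def space_restrict_space abs_mult mult.commute)
    qed
  qed (rule p(1))
  have scaled: "integrable M (\<lambda>t. k t * f t)"
    if k: "continuous_on {0..T} k" and f: "integrable M f" for k f :: "real \<Rightarrow> real"
  proof -
    obtain B where B: "\<And>t. t \<in> {0..T} \<Longrightarrow> \<bar>k t\<bar> \<le> B"
      using compact_imp_bounded[OF compact_continuous_image[OF k compact_Icc]]
      unfolding bounded_iff by fastforce
    have kM: "k \<in> borel_measurable M"
    proof -
      have "continuous_on {0<..<T} k" by (rule continuous_on_subset[OF k]) auto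
      then have "k \<in> borel_measurable (restrict_space borel {0<..<T})"
        by (rule borel_measurable_continuous_on_restrict)
      then show ?thesis
        by (simp add: M_def measurable_def sets_restrict_space space_restrict_space)
    qed
    show ?thesis
    proof (rule Bochner_Integration.integrable_bound)
      show "integrable M (\<lambda>t. B * f t)" using f by simp
      show "(\<lambda>t. k t * f t) \<in> borel_measurable M"
        using kM f by (intro borel_measurable_times) auto
      show "AE t in M. norm (k t * f t) \<le> norm (B * f t)"
        using AE_space
      proof eventually_elim
        case (elim t)
        then have "\<bar>k t\<bar> \<le> \<bar>B\<bar>" using B[of t] by (auto simp: M_def space_restrict_space)
        then show ?case by (simp add: abs_mult mult_right_mono)
      qed
    qed
  qed
  have qM: "integrable M (\<lambda>t. q t)"
    using scaled[of q "\<lambda>_. 1"] cont finite_measure.integrable_const[OF fin, of "1::real"]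
    by (simp add: q_def[abs_def])
  have by_parts: "(LINT r:{0<..<T}|lborel. deriv \<phi> r * q r) = - (LINT r:{0<..<T}|lborel. \<phi> r * p r)"
    if \<phi>: "test_function T \<phi>" for \<phi>
  proof -
    obtain g where g: "has_L2_integral M \<nu> (\<lambda>t x. deriv \<phi> t * u t x) g"
      "has_L2_integral M \<nu> (\<lambda>t x. \<phi> t * v t x) (\<lambda>x. - g x)"
      using weak[OF \<phi>] by blast
    obtain D where D: "D 0 = \<phi>" "\<And>k t. (D k has_real_derivative D (Suc k) t) (at t)"
      using \<phi> unfolding test_function_def by blast
    have cont_D: "continuous_on {0..T} (D k)" for k
      by (auto intro!: continuous_at_imp_continuous_on DERIV_isCont D(2))
    have deriv_eq: "deriv \<phi> = D 1"
      using D(2)[of 0] D(1) by (auto simp: fun_eq_iff intro!: DERIV_imp_deriv)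
    have "(\<integral>t. deriv \<phi> t * q t \<partial>M) = (\<integral>x. g x * h x \<partial>\<nu>)"
    proof (rule has_L2_integral_pairing[OF fin g(1) h])
      show "integrable M (\<lambda>t. deriv \<phi> t * q t)"
        unfolding deriv_eq by (rule scaled[OF cont_D qM])
    qed (simp add: q_def mult.assoc)
    moreover have "(\<integral>t. \<phi> t * p t \<partial>M) = (\<integral>x. - g x * h x \<partial>\<nu>)"
    proof (rule has_L2_integral_pairing[OF fin g(2) h])
      show "integrable M (\<lambda>t. \<phi> t * p t)"
        using scaled[OF cont_D pM, of 0] D(1) by simp
      show "AE t in M. \<phi> t * p t = (\<integral>x. \<phi> t * v t x * h x \<partial>\<nu>)"
        using p(2) by eventually_elim (simp add: mult.assoc)
    qed
    ultimately have "(\<integral>t. deriv \<phi> t * q t \<partial>M) = - (\<integral>t. \<phi> t * p t \<partial>M)" by simp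
    then show ?thesis
      by (simp add: M_def set_lebesgue_integral_def integral_restrict_space)
  qed
  have p_lborel: "set_integrable lborel {0<..<T} p"
    using pM by (simp add: M_def set_integrable_def integrable_restrict_space)
  show ?thesis
  proof (intro exI[of _ p] conjI allI impI p_lborel)
    show "AE t in lborel. t \<in> {0<..<T} \<longrightarrow> p t = (\<integral>x. v t x * h x \<partial>\<nu>)"
      using p(2) unfolding M_def by (simp add: AE_restrict_space_iff)
    fix s t assume "0 < s" "s < t" "t < T"
    from weak_derivative_FTC[OF this, of q p] cont p_lborel by_parts
    show "(\<integral>x. u t x * h x \<partial>\<nu>) - (\<integral>x. u s x * h x \<partial>\<nu>) = (LINT r:{s..t}|lborel. p r)"
      by (simp add: q_def[abs_def])
  qed
qed

section \<open>Subgradients of the total variation\<close>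

text \<open>The defining infimum, multiplied out. A function of norm 0 is not a competitor, but for it the
  inequality is trivial.\<close>

lemma poincare_constant_le_TV:
  assumes fin: "finite_measure \<nu>" and f: "f \<in> Lp_space 2 \<nu>" and zero: "(\<integral>x. f x \<partial>\<nu>) = 0"
  shows "poincare_constant 2 m \<nu> * Lp_norm 2 \<nu> f \<le> TV m \<nu> f"
proof (cases "Lp_norm 2 \<nu> f = 0")
  case False
  have finite: "Lp_norm 2 \<nu> f \<noteq> \<top>" using f by (simp add: Lp_norm_2_eq)
  have "poincare_constant 2 m \<nu> \<le> TV m \<nu> f / Lp_norm 2 \<nu> f"
    unfolding poincare_constant_def using False zero L2_imp_L1(2)[OF fin f]
    by (intro INF_lower) auto
  then have "poincare_constant 2 m \<nu> * Lp_norm 2 \<nu> f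
      \<le> TV m \<nu> f / Lp_norm 2 \<nu> f * Lp_norm 2 \<nu> f"
    by (rule mult_right_mono) simp
  also have "\<dots> = TV m \<nu> f * (Lp_norm 2 \<nu> f / Lp_norm 2 \<nu> f)"
    by (simp add: ennreal_divide_times)
  also have "\<dots> = TV m \<nu> f"
    using False finite by (simp add: ennreal_divide_self less_top)
  finally show ?thesis .
qed simp

lemma TV_add_const: "TV m \<nu> (\<lambda>x. f x + c) = TV m \<nu> f"
  by (simp add: TV_def)

lemma one_laplacian_L2: "v \<in> one_laplacian m \<nu> u \<Longrightarrow> v \<in> Lp_space 2 \<nu>"
  using L2_uminus[of "\<lambda>x. - v x" \<nu>] by (simp add: one_laplacian_def TV_subdifferential_def)

lemma one_laplacian_inequality:
  assumes v: "v \<in> one_laplacian m \<nu> u" and z: "z \<in> Lp_space 2 \<nu>" and TV_z: "TV m \<nu> z = ennreal b" "b \<ge> 0"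
  shows "enn2real (TV m \<nu> u) \<le> b + (\<integral>x. v x * (z x - u x) \<partial>\<nu>)"
proof -
  have "TV m \<nu> u < \<infinity>"
    and "enn2ereal (TV m \<nu> u) + ereal (\<integral>x. - v x * (z x - u x) \<partial>\<nu>) \<le> enn2ereal (TV m \<nu> z)"
    using v z by (auto simp: one_laplacian_def TV_subdifferential_def)
  moreover from this obtain a where "a \<ge> 0" "TV m \<nu> u = ennreal a"
    by (cases "TV m \<nu> u") auto
  ultimately show ?thesis using TV_z by (simp add: enn2ereal_ennreal)
qed

text \<open>Adding a constant \<open>c\<close> to \<open>u\<close> does not change the total variation, so the subgradient inequality
  with \<open>z = u + c\<close> bounds \<open>c\<close> times the integral of \<open>v\<close> from one side, for both signs of \<open>c\<close>.\<close>

lemma one_laplacian_integral_0: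
  assumes fin: "finite_measure \<nu>" and v: "v \<in> one_laplacian m \<nu> u"
  shows "(\<integral>x. v x \<partial>\<nu>) = 0"
proof -
  have u: "u \<in> Lp_space 2 \<nu>" and finite: "TV m \<nu> u < \<infinity>"
    using v by (auto simp: one_laplacian_def TV_subdifferential_def)
  have TV_u: "TV m \<nu> u = ennreal (enn2real (TV m \<nu> u))"
    using finite by simp
  have "0 \<le> c * (\<integral>x. v x \<partial>\<nu>)" for c
  proof -
    have "(\<lambda>x. u x + c) \<in> Lp_space 2 \<nu>"
      using L2_lincomb[OF u L2_const[OF fin, of c], of 1 1] by simp
    then have "enn2real (TV m \<nu> u) \<le> enn2real (TV m \<nu> u) + (\<integral>x. v x * (u x + c - u x) \<partial>\<nu>)"
      using TV_u by (intro one_laplacian_inequality[OF v]) (simp_all add: TV_add_const)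
    then show ?thesis by (simp add: mult.commute)
  qed
  from this[of 1] this[of "-1"] show ?thesis by simp
qed

text \<open>The competitor is the constant function \<open>c\<close>, whose total variation is 0. The subgradient
  inequality then says that the total variation of \<open>u\<close> is at most \<open>\<langle>- v, u - c\<rangle>\<close>, and it is bounded
  below by the Poincare constant because \<open>u - c\<close> has mean zero.\<close>

lemma one_laplacian_dissipation:
  assumes fin: "finite_measure \<nu>" and v: "v \<in> one_laplacian m \<nu> u"
    and zero: "(\<integral>x. u x - c \<partial>\<nu>) = 0"
    and lam: "lam \<ge> 0" "ennreal lam \<le> poincare_constant 2 m \<nu>"
  shows "(\<integral>x. v x * (u x - c) \<partial>\<nu>) \<le> - lam * L2_norm \<nu> (\<lambda>x. u x - c)"
proof -
  have u: "u \<in> Lp_space 2 \<nu>" and finite: "TV m \<nu> u < \<infinity>"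
    using v by (auto simp: one_laplacian_def TV_subdifferential_def)
  note u_c = L2_diff[OF u L2_const[OF fin, of c]]
  have "ennreal lam * Lp_norm 2 \<nu> (\<lambda>x. u x - c)
      \<le> poincare_constant 2 m \<nu> * Lp_norm 2 \<nu> (\<lambda>x. u x - c)"
    by (rule mult_right_mono[OF lam(2)]) simp
  also have "\<dots> \<le> TV m \<nu> (\<lambda>x. u x - c)"
    by (rule poincare_constant_le_TV[OF fin u_c zero])
  also have "\<dots> = TV m \<nu> u"
    using TV_add_const[of m \<nu> u "- c"] by simp
  finally have "lam * L2_norm \<nu> (\<lambda>x. u x - c) \<le> enn2real (TV m \<nu> u)"
    using lam(1) finite by (cases "TV m \<nu> u") (auto simp: Lp_norm_2_eq[OF u_c] ennreal_mult''[symmetric])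
  also have "\<dots> \<le> (\<integral>x. v x * (c - u x) \<partial>\<nu>)"
    using one_laplacian_inequality[OF v L2_const[OF fin, of c], of 0] by (simp add: TV_def)
  also have "\<dots> = - (\<integral>x. v x * (u x - c) \<partial>\<nu>)"
    by (subst Bochner_Integration.integral_minus[symmetric])
      (auto intro!: Bochner_Integration.integral_cong simp: algebra_simps)
  finally show ?thesis by simp
qed

section \<open>Continuity and mass of the flow\<close>

lemma flow_tendsto_real:
  assumes flow: "total_variation_flow m \<nu> u0 u" and "t \<ge> 0"
  shows "((\<lambda>s. L2_norm \<nu> (\<lambda>x. u s x - u t x)) \<longlongrightarrow> 0) (at t within {0..})"
proof -
  have uL2: "u s \<in> Lp_space 2 \<nu>" if "s \<ge> 0" for s
    using flow that unfolding total_variation_flow_def by blast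
  have "((\<lambda>s. Lp_norm 2 \<nu> (\<lambda>x. u s x - u t x)) \<longlongrightarrow> 0) (at t within {0..})"
    using flow \<open>t \<ge> 0\<close> unfolding total_variation_flow_def by blast
  then have "((\<lambda>s. ennreal (L2_norm \<nu> (\<lambda>x. u s x - u t x))) \<longlongrightarrow> ennreal 0) (at t within {0..})"
  proof (subst ennreal_0, rule Lim_transform_eventually)
    show "\<forall>\<^sub>F s in at t within {0..}. Lp_norm 2 \<nu> (\<lambda>x. u s x - u t x)
        = ennreal (L2_norm \<nu> (\<lambda>x. u s x - u t x))"
      using \<open>t \<ge> 0\<close>
      by (auto simp: eventually_at_filter intro!: always_eventually Lp_norm_2_eq L2_diff uL2)
  qed
  then show ?thesis by (rule tendsto_ennrealD) auto
qed

lemma flow_functional_continuous: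
  fixes F :: "('a \<Rightarrow> real) \<Rightarrow> real"
  assumes flow: "total_variation_flow m \<nu> u0 u"
    and lipschitz: "\<And>f g. f \<in> Lp_space 2 \<nu> \<Longrightarrow> g \<in> Lp_space 2 \<nu> \<Longrightarrow>
      \<bar>F f - F g\<bar> \<le> C * L2_norm \<nu> (\<lambda>x. f x - g x)"
  shows "continuous_on {0..} (\<lambda>t. F (u t))"
  unfolding continuous_on_def
proof
  have uL2: "u t \<in> Lp_space 2 \<nu>" if "t \<ge> 0" for t
    using flow that unfolding total_variation_flow_def by blast
  fix t :: real assume "t \<in> {0..}"
  then have t: "t \<ge> 0" by simp
  have "((\<lambda>s. F (u s) - F (u t)) \<longlongrightarrow> 0) (at t within {0..})"
  proof (rule Lim_null_comparison)
    show "((\<lambda>s. C * L2_norm \<nu> (\<lambda>x. u s x - u t x)) \<longlongrightarrow> 0) (at t within {0..})"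
      by (rule tendsto_mult_right_zero[OF flow_tendsto_real[OF flow t]])
    show "\<forall>\<^sub>F s in at t within {0..}. norm (F (u s) - F (u t)) \<le> C * L2_norm \<nu> (\<lambda>x. u s x - u t x)"
      using t by (auto simp: eventually_at_filter intro!: always_eventually lipschitz uL2)
  qed
  then show "((\<lambda>s. F (u s)) \<longlongrightarrow> F (u t)) (at t within {0..})"
    by (rule LIM_zero_cancel)
qed

lemma flow_pairing_continuous:
  assumes "total_variation_flow m \<nu> u0 u" "h \<in> Lp_space 2 \<nu>"
  shows "continuous_on {0..} (\<lambda>t. \<integral>x. u t x * h x \<partial>\<nu>)"
  by (rule flow_functional_continuous[OF assms(1),
        where F = "\<lambda>f. \<integral>x. f x * h x \<partial>\<nu>" and C = "L2_norm \<nu> h"])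
    (rule L2_pairing_lipschitz[OF _ _ assms(2)])

text \<open>The velocity is orthogonal to the constants, so the integral is constant on the open time interval;
  continuity extends this to time 0.\<close>

lemma flow_mass_conservation:
  assumes fin: "finite_measure \<nu>" and flow: "total_variation_flow m \<nu> u0 u" and "t \<ge> 0"
  shows "(\<integral>x. u t x \<partial>\<nu>) = (\<integral>x. u 0 x \<partial>\<nu>)"
proof (cases "t = 0")
  case False
  then have t: "t > 0" using \<open>t \<ge> 0\<close> by simp
  have one: "(\<lambda>_. 1) \<in> Lp_space 2 \<nu>" by (rule L2_const[OF fin])
  have cont: "continuous_on {0..} (\<lambda>t. \<integral>x. u t x * 1 \<partial>\<nu>)"
    by (rule flow_pairing_continuous[OF flow one])
  obtain v where W: "W11_derivative (t + 1) \<nu> u v"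
    and v: "AE r in lborel. r \<in> {0<..<t + 1} \<longrightarrow> v r \<in> one_laplacian m \<nu> (u r)"
    using flow t unfolding total_variation_flow_def by (auto dest!: spec[of _ "t + 1"])
  have "continuous_on {0..t + 1} (\<lambda>t. \<integral>x. u t x * 1 \<partial>\<nu>)"
    by (rule continuous_on_subset[OF cont]) auto
  from W11_pairing_FTC[OF W one this]
  obtain p where p: "AE r in lborel. r \<in> {0<..<t + 1} \<longrightarrow> p r = (\<integral>x. v r x * 1 \<partial>\<nu>)"
    and ftc: "\<forall>s r. 0 < s \<longrightarrow> s < r \<longrightarrow> r < t + 1 \<longrightarrow>
      (\<integral>x. u r x * 1 \<partial>\<nu>) - (\<integral>x. u s x * 1 \<partial>\<nu>) = (LINT r:{s..r}|lborel. p r)"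
    by blast
  have const: "(\<integral>x. u s x * 1 \<partial>\<nu>) = (\<integral>x. u t x * 1 \<partial>\<nu>)" if "s \<in> {0<..<t}" for s
  proof -
    have "AE r in lborel. indicator {s..t} r *\<^sub>R p r = 0"
      using p v
    proof eventually_elim
      case (elim r)
      then show ?case using that one_laplacian_integral_0[OF fin, of "v r" m "u r"]
        by (auto simp: indicator_def)
    qed
    then have "(LINT r:{s..t}|lborel. p r) = 0"
      unfolding set_lebesgue_integral_def by (rule integral_eq_zero_AE)
    then show ?thesis using ftc[rule_format, of s t] that by simp
  qed
  have clos: "closure {0<..<t} = {0..t}" using t by simp
  have "(\<integral>x. u 0 x * 1 \<partial>\<nu>) = (\<integral>x. u t x * 1 \<partial>\<nu>)"
  proof (rule continuous_constant_on_closure[of "{0<..<t}" "\<lambda>s. \<integral>x. u s x * 1 \<partial>\<nu>"])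
    show "continuous_on (closure {0<..<t}) (\<lambda>s. \<integral>x. u s x * 1 \<partial>\<nu>)"
      unfolding clos by (rule continuous_on_subset[OF cont]) auto
    show "0 \<in> closure {0<..<t}" unfolding clos using t by simp
  qed (rule const)
  then show ?thesis by simp
qed simp

section \<open>Decay of the norm\<close>

text \<open>Formally \<open>N N' = \<langle>v, U\<rangle> \<le> - lam N\<close> for \<open>U = u - c\<close> and \<open>N = \<parallel>U\<parallel>\<close>, and one divides by
  \<open>N > 0\<close>. To avoid differentiating \<open>N\<close>, the equation is paired on a short interval \<open>[s, t]\<close> with
  the fixed element \<open>U t\<close>:
  \<open>N t (N t - N s) \<le> \<langle>U t - U s, U t\<rangle>\<close>, which is the integral of \<open>\<langle>v r, U t\<rangle>\<close> over \<open>[s, t]\<close>.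
  Replacing \<open>U t\<close> by \<open>U r\<close> costs at most \<open>\<parallel>v r\<parallel> \<parallel>u t - u r\<parallel>\<close>, which on a short interval is at
  most \<open>\<epsilon> N t \<parallel>v r\<parallel>\<close> by continuity of the flow; replacing \<open>lam N r\<close> by \<open>lam N t\<close> costs at most
  \<open>\<epsilon> N t lam\<close>. The total error on a long interval is then
  \<open>\<epsilon>\<close> times a finite integral. The bisection principle passes from short intervals to \<open>[a, b]\<close>.\<close>

lemma flow_norm_decrease_positive:
  assumes fin: "finite_measure \<nu>" and flow: "total_variation_flow m \<nu> u0 u"
    and mean_zero: "\<And>t. t \<ge> 0 \<Longrightarrow> (\<integral>x. u t x - c \<partial>\<nu>) = 0"
    and lam: "lam \<ge> 0" "ennreal lam \<le> poincare_constant 2 m \<nu>"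
    and ab: "0 < a" "a \<le> b"
    and pos: "\<And>t. t \<in> {a..b} \<Longrightarrow> L2_norm \<nu> (\<lambda>x. u t x - c) > 0"
  shows "L2_norm \<nu> (\<lambda>x. u b x - c) - L2_norm \<nu> (\<lambda>x. u a x - c) \<le> - lam * (b - a)"
proof -
  define T where "T = b + 1"
  define U where "U = (\<lambda>t x. u t x - c)"
  define N where "N t = L2_norm \<nu> (U t)" for t
  have uL2: "u t \<in> Lp_space 2 \<nu>" if "t \<ge> 0" for t
    using flow that unfolding total_variation_flow_def by blast
  have UL2: "U t \<in> Lp_space 2 \<nu>" if "t \<ge> 0" for t
    unfolding U_def by (rule L2_diff[OF uL2[OF that] L2_const[OF fin]])
  have "T > 0" using ab by (simp add: T_def)
  then obtain v where W: "W11_derivative T \<nu> u v"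
    and v: "AE r in lborel. r \<in> {0<..<T} \<longrightarrow> v r \<in> one_laplacian m \<nu> (u r)"
    using flow unfolding total_variation_flow_def by blast
  obtain G where G: "set_integrable lborel {0<..<T} G"
    and G_eq: "AE t in lborel. t \<in> {0<..<T} \<longrightarrow> G t = L2_norm \<nu> (v t)"
    using W11_norm_integrable[OF W] by blast
  define K where "K r = indicator {0<..<T} r * (lam + G r)" for r
  have K: "integrable lborel K"
  proof -
    have "set_integrable lborel {0<..<T} (\<lambda>r. lam + G r)"
      using \<open>T > 0\<close> G by (intro set_integral_add) (simp_all add: set_integrable_def)
    then show ?thesis by (simp add: set_integrable_def K_def[abs_def])
  qed
  have KI: "set_integrable lborel A K" if "A \<in> sets lborel" for A
    using integrable_mult_indicator[OF that K] by (simp add: set_integrable_def)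
  \<comment> \<open>A primitive of the error density, so that the local estimates add up telescopically.\<close>
  define V where "V t = (LINT r:{..t}|lborel. K r)" for t
  have V_diff: "V t - V s = (LINT r:{s..t}|lborel. K r)" if "s \<le> t" for s t
  proof -
    have "V t - V s = (\<integral>r. indicator {..t} r *\<^sub>R K r - indicator {..s} r *\<^sub>R K r \<partial>lborel)"
      using KI[of "{..t}"] KI[of "{..s}"]
      unfolding V_def set_lebesgue_integral_def set_integrable_def by simp
    also have "\<dots> = (LINT r:{s..t}|lborel. K r)"
      unfolding set_lebesgue_integral_def
    proof (rule integral_cong_AE)
      show "AE r in lborel. indicator {..t} r *\<^sub>R K r - indicator {..s} r *\<^sub>R K r
          = indicator {s..t} r *\<^sub>R K r"
        using AE_lborel_singleton[of s] by eventually_elim (use that in \<open>auto simp: indicator_def\<close>)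
    qed (use K in auto)
    finally show ?thesis .
  qed
  have main: "N b - N a \<le> - lam * (b - a) + \<epsilon> * (V b - V a)" if eps: "0 < \<epsilon>" "\<epsilon> \<le> 1" for \<epsilon>
    using \<open>a \<le> b\<close>
  proof (induction a b rule: Bolzano)
    case (trans r s t)
    then show ?case by (simp add: algebra_simps)
  next
    case (local x)
    then have x: "0 < x" "x < T" using ab by (auto simp: T_def)
    have Nx: "N x > 0" using pos[of x] local by (simp add: N_def U_def)
    \<comment> \<open>With this tolerance, \<open>u\<close> varies by less than \<open>\<epsilon> N x / 2\<close> and \<open>N\<close> stays above \<open>N x / 2\<close>.\<close>
    define \<eta> where "\<eta> = \<epsilon> * N x / 4"
    have "\<eta> > 0" using Nx eps by (simp add: \<eta>_def)
    have "\<forall>\<^sub>F s in at x within {0..}. L2_norm \<nu> (\<lambda>y. u s y - u x y) < \<eta>"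
    proof -
      have "((\<lambda>s. L2_norm \<nu> (\<lambda>y. u s y - u x y)) \<longlongrightarrow> 0) (at x within {0..})"
        using x by (intro flow_tendsto_real[OF flow]) simp
      then show ?thesis by (rule order_tendstoD(2)) fact
    qed
    then obtain \<delta> where "\<delta> > 0" and \<delta>: "\<And>s. s \<ge> 0 \<Longrightarrow> s \<noteq> x \<Longrightarrow> dist s x < \<delta> \<Longrightarrow>
        L2_norm \<nu> (\<lambda>y. u s y - u x y) < \<eta>"
      unfolding eventually_at by auto
    have near: "L2_norm \<nu> (\<lambda>y. u s y - u x y) < \<eta>" if "s \<ge> 0" "\<bar>s - x\<bar> < \<delta>" for s
      using \<delta>[of s] that \<open>\<eta> > 0\<close> by (cases "s = x") (auto simp: L2_norm_def dist_real_def)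
    define d where "d = min \<delta> (min x (T - x))"
    have "d > 0" using \<open>\<delta> > 0\<close> x by (simp add: d_def)
    moreover have "N t - N s \<le> - lam * (t - s) + \<epsilon> * (V t - V s)"
      if st: "s \<le> x" "x \<le> t" "t - s < d" for s t
    proof (cases "s = t")
      case False
      then have order: "0 < s" "s < t" "t < T" using st by (auto simp: d_def)
      have close: "L2_norm \<nu> (\<lambda>y. u t y - u r y) \<le> \<epsilon> * N t"
        and N_close: "N r \<ge> (1 - \<epsilon>) * N t" and Nt_pos: "N t > 0" if r: "r \<in> {s..t}" for r
      proof -
        have near_t: "L2_norm \<nu> (\<lambda>y. u t y - u x y) < \<eta>"
          using order st by (intro near) (auto simp: d_def)
        have near_r: "L2_norm \<nu> (\<lambda>y. u r y - u x y) < \<eta>"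
          using order st r by (intro near) (auto simp: d_def)
        have t0: "t \<ge> 0" and r0: "r \<ge> 0" and x0: "x \<ge> 0" using order r x by auto
        have diff: "(\<lambda>y. U p y - U q y) = (\<lambda>y. u p y - u q y)" for p q
          by (simp add: U_def fun_eq_iff)
        have "L2_norm \<nu> (\<lambda>y. u t y - u r y) \<le> L2_norm \<nu> (\<lambda>y. u t y - u x y)
            + L2_norm \<nu> (\<lambda>y. u r y - u x y)"
          using L2_norm_triangle[OF L2_diff[OF uL2[OF t0] uL2[OF r0]] L2_diff[OF uL2[OF t0] uL2[OF x0]]]
          by (simp add: L2_norm_minus_commute[of \<nu> "u x" "u r"])
        then have tr: "L2_norm \<nu> (\<lambda>y. u t y - u r y) \<le> \<epsilon> * (N x / 2)"
          using near_t near_r by (simp add: \<eta>_def)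
        have "N x \<le> N t + \<eta>"
          using L2_norm_diff_abs[OF UL2[OF x0] UL2[OF t0]] near_t
          by (simp add: N_def diff L2_norm_minus_commute[of \<nu> "u x" "u t"])
        moreover have "\<eta> \<le> N x / 2"
          using Nx eps mult_right_mono[of \<epsilon> 1 "N x"] by (simp add: \<eta>_def)
        ultimately have Nt: "N x / 2 \<le> N t" by simp
        then show "N t > 0" using Nx by simp
        show close: "L2_norm \<nu> (\<lambda>y. u t y - u r y) \<le> \<epsilon> * N t"
          using tr mult_left_mono[OF Nt, of \<epsilon>] eps by linarith
        have "N t \<le> N r + L2_norm \<nu> (\<lambda>y. u t y - u r y)"
          using L2_norm_triangle[OF UL2[OF t0] UL2[OF r0]] by (simp add: N_def diff)
        then show "N r \<ge> (1 - \<epsilon>) * N t" using close by (simp add: algebra_simps)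
      qed
      have Nt: "N t > 0" using order by (intro Nt_pos[of t]) auto
      have t0: "t \<ge> 0" and s0: "s \<ge> 0" using order by auto
      note Ut = UL2[OF t0]
      have "continuous_on {0..T} (\<lambda>r. \<integral>y. u r y * U t y \<partial>\<nu>)"
        by (rule continuous_on_subset[OF flow_pairing_continuous[OF flow Ut]]) auto
      from W11_pairing_FTC[OF W Ut this]
      obtain p where p: "set_integrable lborel {0<..<T} p"
        and p_eq: "AE r in lborel. r \<in> {0<..<T} \<longrightarrow> p r = (\<integral>y. v r y * U t y \<partial>\<nu>)"
        and ftc: "\<forall>s r. 0 < s \<longrightarrow> s < r \<longrightarrow> r < T \<longrightarrow>
          (\<integral>y. u r y * U t y \<partial>\<nu>) - (\<integral>y. u s y * U t y \<partial>\<nu>) = (LINT r:{s..r}|lborel. p r)"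
        by blast
      have bound: "AE r in lborel. r \<in> {s..t} \<longrightarrow> p r \<le> N t * (- lam + \<epsilon> * K r)"
        using p_eq v G_eq
      proof eventually_elim
        case (elim r)
        show ?case
        proof
          assume r: "r \<in> {s..t}"
          then have rT: "r \<in> {0<..<T}" and r0: "r \<ge> 0" using order by auto
          then have vr: "v r \<in> one_laplacian m \<nu> (u r)" using elim by blast
          note vL2 = one_laplacian_L2[OF vr]
          have "p r = (\<integral>y. v r y * (u r y - c) + v r y * (u t y - u r y) \<partial>\<nu>)"
            using elim rT by (auto intro!: Bochner_Integration.integral_cong simp: U_def algebra_simps)
          also have "\<dots> = (\<integral>y. v r y * (u r y - c) \<partial>\<nu>) + (\<integral>y. v r y * (u t y - u r y) \<partial>\<nu>)"
            using L2_mult_integrable[OF vL2 UL2[OF r0]]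
              L2_mult_integrable[OF vL2 L2_diff[OF uL2[OF t0] uL2[OF r0]]]
            by (intro Bochner_Integration.integral_add) (simp_all add: U_def)
          also have "(\<integral>y. v r y * (u r y - c) \<partial>\<nu>) \<le> - lam * N r"
            using one_laplacian_dissipation[OF fin vr mean_zero[OF r0] lam] by (simp add: N_def U_def)
          also have "- lam * N r \<le> - lam * ((1 - \<epsilon>) * N t)"
            using mult_left_mono[OF N_close[OF r] lam(1)] by simp
          also have "(\<integral>y. v r y * (u t y - u r y) \<partial>\<nu>) \<le> G r * L2_norm \<nu> (\<lambda>y. u t y - u r y)"
            using L2_Cauchy_Schwarz[OF vL2 L2_diff[OF uL2[OF t0] uL2[OF r0]]] elim rT by simp
          also have "\<dots> \<le> G r * (\<epsilon> * N t)"
            using elim rT by (intro mult_left_mono close[OF r]) simp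
          also have "- lam * ((1 - \<epsilon>) * N t) + G r * (\<epsilon> * N t) = N t * (- lam + \<epsilon> * K r)"
            using rT by (simp add: K_def algebra_simps)
          finally show "p r \<le> N t * (- lam + \<epsilon> * K r)" by simp
        qed
      qed
      have sub: "{s..t} \<subseteq> {0<..<T}" using order by auto
      have const_int: "set_integrable lborel {s..t} (\<lambda>r. - lam)"
        using order by (simp add: set_integrable_def)
      have K_int: "set_integrable lborel {s..t} (\<lambda>r. \<epsilon> * K r)"
        by (intro set_integrable_mult_right KI) simp
      note int = set_integral_add(1)[OF const_int K_int]
      have "N t * (N t - N s) \<le> N t * N t - (\<integral>y. U s y * U t y \<partial>\<nu>)"
        using L2_Cauchy_Schwarz[OF UL2[OF s0] Ut] by (simp add: N_def algebra_simps)
      also have "\<dots> = (\<integral>y. U t y * U t y - U s y * U t y \<partial>\<nu>)"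
        using L2_mult_integrable[OF Ut Ut] L2_mult_integrable[OF UL2[OF s0] Ut] L2_norm_power2[of \<nu> "U t"]
        by (simp add: N_def power2_eq_square)
      also have "\<dots> = (\<integral>y. u t y * U t y - u s y * U t y \<partial>\<nu>)"
        by (intro Bochner_Integration.integral_cong) (auto simp: U_def algebra_simps)
      also have "\<dots> = (LINT r:{s..t}|lborel. p r)"
        using ftc[rule_format, OF order] L2_mult_integrable[OF uL2[OF t0] Ut]
          L2_mult_integrable[OF uL2[OF s0] Ut] by simp
      also have "\<dots> \<le> (LINT r:{s..t}|lborel. N t * (- lam + \<epsilon> * K r))"
      proof (rule set_integral_mono_AE)
        show "set_integrable lborel {s..t} p"
          by (rule set_integrable_subset[OF p]) (use sub in auto)
        show "set_integrable lborel {s..t} (\<lambda>r. N t * (- lam + \<epsilon> * K r))"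
          using int by (rule set_integrable_mult_right)
      qed (use bound in auto)
      also have "\<dots> = N t * (LINT r:{s..t}|lborel. - lam + \<epsilon> * K r)"
        by simp
      also have "(LINT r:{s..t}|lborel. - lam + \<epsilon> * K r) = - lam * (t - s) + \<epsilon> * (V t - V s)"
      proof -
        have "(LINT r:{s..t}|lborel. - lam) = - lam * (t - s)"
          using order by (simp add: set_lebesgue_integral_def)
        then show ?thesis
          using set_integral_add(2)[OF const_int K_int] V_diff[of s t] order by simp
      qed
      finally show ?thesis using Nt by simp
    qed simp
    ultimately show ?case by blast
  qed
  have "N b - N a + lam * (b - a) \<le> 0"
  proof (rule field_le_epsilon)
    fix e :: real assume "e > 0"
    define k where "k = \<bar>V b - V a\<bar> + 1"
    define \<epsilon> where "\<epsilon> = min 1 (e / k)"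
    have k: "k > 0" "V b - V a \<le> k" by (auto simp: k_def)
    have eps: "0 < \<epsilon>" "\<epsilon> \<le> 1" "\<epsilon> * k \<le> e"
      using k \<open>e > 0\<close> by (auto simp: \<epsilon>_def min_def field_simps)
    have "N b - N a + lam * (b - a) \<le> \<epsilon> * (V b - V a)"
      using main[OF eps(1,2)] by simp
    also have "\<dots> \<le> \<epsilon> * k" using k eps by (intro mult_left_mono) auto
    finally show "N b - N a + lam * (b - a) \<le> 0 + e" using eps by simp
  qed
  then show ?thesis by (simp add: N_def U_def)
qed

lemma flow_norm_continuous:
  assumes fin: "finite_measure \<nu>" and flow: "total_variation_flow m \<nu> u0 u"
  shows "continuous_on {0..} (\<lambda>t. L2_norm \<nu> (\<lambda>x. u t x - c))"
proof (rule flow_functional_continuous[OF flow, where F = "\<lambda>f. L2_norm \<nu> (\<lambda>x. f x - c)" and C = 1])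
  fix f g assume fg: "f \<in> Lp_space 2 \<nu>" "g \<in> Lp_space 2 \<nu>"
  show "\<bar>L2_norm \<nu> (\<lambda>x. f x - c) - L2_norm \<nu> (\<lambda>x. g x - c)\<bar> \<le> 1 * L2_norm \<nu> (\<lambda>x. f x - g x)"
    using L2_norm_diff_abs[OF L2_diff[OF fg(1) L2_const[OF fin, of c]]
        L2_diff[OF fg(2) L2_const[OF fin, of c]]] by simp
qed

text \<open>As long as the norm is positive it decreases at rate \<open>lam\<close>. It remains to exclude that it becomes
  positive again after a zero: starting from the last zero before \<open>t\<close>, the decrease would
  make it nonpositive at time \<open>t\<close>. Continuity extends the decrease to intervals whose left endpoint is
  a zero or time 0.\<close>

lemma flow_norm_decay:
  assumes fin: "finite_measure \<nu>" and u0: "u0 \<in> Lp_space 2 \<nu>"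
    and flow: "total_variation_flow m \<nu> u0 u"
    and lam: "lam \<ge> 0" "ennreal lam \<le> poincare_constant 2 m \<nu>" and "t \<ge> 0"
  shows "L2_norm \<nu> (\<lambda>x. u t x - mean \<nu> u0)
    \<le> max (L2_norm \<nu> (\<lambda>x. u0 x - mean \<nu> u0) - lam * t) 0"
proof -
  interpret finite_measure \<nu> by (rule fin)
  define c where "c = mean \<nu> u0"
  define N where "N t = L2_norm \<nu> (\<lambda>x. u t x - c)" for t
  have uL2: "u t \<in> Lp_space 2 \<nu>" if "t \<ge> 0" for t
    using flow that unfolding total_variation_flow_def by blast
  have init: "AE x in \<nu>. u 0 x = u0 x"
    using flow unfolding total_variation_flow_def by blast
  have [measurable]: "u 0 \<in> borel_measurable \<nu>" "u0 \<in> borel_measurable \<nu>"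
    using uL2[of 0] u0 by (auto simp: L2_iff)
  have mean_zero: "(\<integral>x. u t x - c \<partial>\<nu>) = 0" if "t \<ge> 0" for t
  proof -
    have "(\<integral>x. u t x \<partial>\<nu>) = (\<integral>x. u0 x \<partial>\<nu>)"
      using flow_mass_conservation[OF fin flow that] init
      by (auto intro!: integral_cong_AE)
    also have "\<dots> = c * measure \<nu> (space \<nu>)"
    \<comment> \<open>For the null measure the mean is 0 by the convention \<open>1 / 0 = 0\<close>.\<close>
    proof (cases "measure \<nu> (space \<nu>) = 0")
      case True
      then have "emeasure \<nu> (space \<nu>) = 0" by (simp add: emeasure_eq_measure)
      then have "AE x in \<nu>. u0 x = 0"
        by (intro AE_I[of _ _ "space \<nu>"]) auto
      then have "(\<integral>x. u0 x \<partial>\<nu>) = 0" by (rule integral_eq_zero_AE)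
      then show ?thesis using True by simp
    qed (simp add: c_def mean_def)
    finally show ?thesis
      using L2_imp_L1(1)[OF fin uL2[OF that]] by simp
  qed
  have N_cont: "continuous_on {0..} N"
    unfolding N_def by (rule flow_norm_continuous[OF fin flow])
  have decrease: "N b + lam * (b - a) \<le> N a"
    if ab: "0 \<le> a" "a < b" and pos: "\<And>s. s \<in> {a<..b} \<Longrightarrow> N s > 0" for a b
  proof -
    have clos: "closure {a<..<b} = {a..b}" using ab by simp
    have "N b + lam * b \<le> N a + lam * a"
    proof (rule continuous_ge_on_closure[of "{a<..<b}" "\<lambda>s. N s + lam * s"])
      show "continuous_on (closure {a<..<b}) (\<lambda>s. N s + lam * s)"
        unfolding clos using ab
        by (intro continuous_intros continuous_on_subset[OF N_cont]) auto
      show "a \<in> closure {a<..<b}" unfolding clos using ab by simp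
      fix s assume s: "s \<in> {a<..<b}"
      have "N b - N s \<le> - lam * (b - s)"
        unfolding N_def
        by (rule flow_norm_decrease_positive[OF fin flow mean_zero lam])
          (use s ab pos in \<open>auto simp: N_def\<close>)
      then show "N b + lam * b \<le> N s + lam * s" by (simp add: algebra_simps)
    qed
    then show ?thesis by (simp add: algebra_simps)
  qed
  have N0: "N 0 = L2_norm \<nu> (\<lambda>x. u0 x - c)"
    unfolding N_def L2_norm_def using init by (intro arg_cong[of _ _ sqrt] integral_cong_AE) auto
  have "N t \<le> max (N 0 - lam * t) 0"
  proof (rule ccontr)
    assume "\<not> N t \<le> max (N 0 - lam * t) 0"
    then have Nt: "N t > 0" "N t > N 0 - lam * t" by auto
    then have "t > 0" using \<open>t \<ge> 0\<close> by (cases "t = 0") auto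
    have N_ge: "N s \<ge> 0" for s by (simp add: N_def)
    define Z where "Z = {s \<in> {0..t}. N s = 0}"
    have "closed Z"
      unfolding Z_def
      by (intro continuous_closed_preimage_constant continuous_on_subset[OF N_cont]) auto
    moreover have "bounded Z" by (rule bounded_subset[of "{0..t}"]) (auto simp: Z_def)
    ultimately have "compact Z" by (simp add: compact_eq_bounded_closed)
    show False
    proof (cases "Z = {}")
      case True
      then have "N s > 0" if "s \<in> {0<..t}" for s
        using that N_ge[of s] by (force simp: Z_def)
      from decrease[OF _ \<open>t > 0\<close> this] Nt show False by simp
    next
      case False
      then obtain z where z: "z \<in> Z" and last: "\<And>s. s \<in> Z \<Longrightarrow> s \<le> z"
        using compact_attains_sup[OF \<open>compact Z\<close>] by blast
      have "0 \<le> z" "z < t" using z Nt by (auto simp: Z_def less_le)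
      moreover have "N s > 0" if "s \<in> {z<..t}" for s
        using last[of s] that N_ge[of s] \<open>0 \<le> z\<close> by (force simp: Z_def)
      ultimately have "N t + lam * (t - z) \<le> N z" by (rule decrease)
      moreover have "0 \<le> lam * (t - z)" using lam(1) \<open>z < t\<close> by simp
      ultimately show False using z Nt by (simp add: Z_def)
    qed
  qed
  then show ?thesis unfolding N0 unfolding N_def c_def .
qed

theorem theorem4p8:
  fixes m :: "'a::polish_space \<Rightarrow> 'a measure" and \<nu> :: "'a measure"
    and u0 :: "'a \<Rightarrow> real" and u :: "real \<Rightarrow> 'a \<Rightarrow> real"
  assumes "reversible_metric_random_walk_space m \<nu>"
    and "m_connected m \<nu>"
    and "emeasure \<nu> (space \<nu>) < \<infinity>"
    and "poincare_inequality 2 m \<nu>"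
    and "u0 \<in> Lp_space 2 \<nu>"
    and "total_variation_flow m \<nu> u0 u"
  shows "(\<forall>t\<ge>0.
            enn2ereal (Lp_norm 2 \<nu> (\<lambda>x. u t x - mean \<nu> u0)) \<le>
              max (enn2ereal (Lp_norm 2 \<nu> (\<lambda>x. u0 x - mean \<nu> u0))
                     - enn2ereal (poincare_constant 2 m \<nu>) * ereal t) 0) \<and>
         (\<forall>t. ereal t \<ge> enn2ereal (Lp_norm 2 \<nu> (\<lambda>x. u0 x - mean \<nu> u0))
                          / enn2ereal (poincare_constant 2 m \<nu>)
            \<longrightarrow> (AE x in \<nu>. u t x = mean \<nu> u0))"
proof -
  have fin: "finite_measure \<nu>"
    using assms(3) by (intro finite_measureI) auto
  note flow = assms(6)
  define c where "c = mean \<nu> u0"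
  define N where "N t = L2_norm \<nu> (\<lambda>x. u t x - c)" for t
  define N0 where "N0 = L2_norm \<nu> (\<lambda>x. u0 x - c)"
  have uL2: "(\<lambda>x. u t x - c) \<in> Lp_space 2 \<nu>" if "t \<ge> 0" for t
    using flow that L2_diff[OF _ L2_const[OF fin]] unfolding total_variation_flow_def by blast
  have Lp_N: "enn2ereal (Lp_norm 2 \<nu> (\<lambda>x. u t x - c)) = ereal (N t)" if "t \<ge> 0" for t
    by (simp add: Lp_norm_2_eq[OF uL2[OF that]] N_def enn2ereal_ennreal)
  have Lp_N0: "enn2ereal (Lp_norm 2 \<nu> (\<lambda>x. u0 x - c)) = ereal N0"
    by (simp add: Lp_norm_2_eq[OF L2_diff[OF assms(5) L2_const[OF fin]]] N0_def enn2ereal_ennreal)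
  have N_nonneg: "N t \<ge> 0" "N0 \<ge> 0" for t by (simp_all add: N_def N0_def)
  have decay: "N t \<le> max (N0 - lam * t) 0"
    if "lam \<ge> 0" "ennreal lam \<le> poincare_constant 2 m \<nu>" "t \<ge> 0" for lam t
    using flow_norm_decay[OF fin assms(5) flow that] by (simp add: N_def N0_def c_def)
  define P where "P = poincare_constant 2 m \<nu>"
  \<comment> \<open>If the constant is infinite, decay holds with every finite rate; the rate \<open>N0 / s\<close>
      gives extinction at any time \<open>s > 0\<close>.\<close>
  have vanish: "N t = 0" if "P = \<top>" "t \<ge> 0" for t
  proof -
    have pos: "N s = 0" if "s > 0" for s
    proof -
      have "N s \<le> max (N0 - N0 / s * s) 0"
        by (rule decay) (use that N_nonneg \<open>P = \<top>\<close> in \<open>auto simp: P_def\<close>)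
      then show ?thesis using that N_nonneg(1)[of s] by simp
    qed
    have clos: "closure {0<..<1} = {0..1::real}" by simp
    have cont: "continuous_on {0..} N"
      unfolding N_def by (rule flow_norm_continuous[OF fin flow])
    have "N 0 = 0"
    proof (rule continuous_constant_on_closure[of "{0<..<1}" N])
      show "continuous_on (closure {0<..<1}) N"
        unfolding clos by (rule continuous_on_subset[OF cont]) auto
      show "0 \<in> closure {0<..<1::real}" unfolding clos by simp
    qed (simp add: pos)
    then show ?thesis using pos[of t] that by (cases "t = 0") auto
  qed
  have bound: "ereal (N t) \<le> max (ereal N0 - enn2ereal P * ereal t) 0" if "t \<ge> 0" for t
  proof (cases P)
    case (real lam)
    then show ?thesis
      using decay[of lam t] that by (simp add: P_def enn2ereal_ennreal max_def split: if_splits)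
  next
    case top
    then show ?thesis using vanish[OF top that] by (intro max.coboundedI2) simp
  qed
  have extinct: "t \<ge> 0 \<and> N t = 0" if le: "ereal N0 / enn2ereal P \<le> ereal t" for t
  proof (cases P)
    case (real lam)
    then have le': "ereal N0 / ereal lam \<le> ereal t"
      using le by (simp add: enn2ereal_ennreal)
    have "t \<ge> 0 \<and> N0 \<le> lam * t"
    proof (cases "lam = 0")
      case True
      \<comment> \<open>Division by zero gives infinity unless the numerator vanishes.\<close>
      then show ?thesis
        using le' N_nonneg(2) unfolding True divide_ereal_def
        by (cases "N0 = 0") (auto simp flip: zero_ereal_def)
    next
      case False
      then have "lam > 0" "N0 / lam \<le> t" using real le' by auto
      moreover have "0 \<le> N0 / lam" using N_nonneg(2) real by simp
      ultimately have "t \<ge> 0" by linarith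
      then show ?thesis using \<open>lam > 0\<close> \<open>N0 / lam \<le> t\<close> by (simp add: field_simps)
    qed
    then show ?thesis using decay[of lam t] real N_nonneg(1)[of t] by (simp add: P_def)
  next
    case top
    then have "t \<ge> 0" using le by simp
    then show ?thesis using vanish[OF top] by simp
  qed
  have "AE x in \<nu>. u t x = c" if "t \<ge> 0" "N t = 0" for t
    using L2_norm_eq_0_iff[OF uL2[OF that(1)]] that(2) by (simp add: N_def)
  then show ?thesis
    unfolding c_def[symmetric] Lp_N0 P_def[symmetric] using bound extinct by (simp add: Lp_N)
qed

end
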